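(* For every $t\in\mathbb R$, every normal state $\omega_\rho\in S_*(\mathfrak B)$ and every $A\in\mathfrak B$, with $A_L=\mathbf\Pi_LA$, $$\lim_{L\to\infty}\big((\mathcal P_L^{(t)}\circ\mathbf\Pi_L')\omega_\rho\big)A_L=(\mathcal P^t\omega_\rho)A.$$ In particular, if $f\in\mathfrak A$, $\omega_p\in S_*(\mathfrak A)$ and $\omega_\rho=\Gamma(\omega_p)$, then $$\lim_{L\to\infty}\big((\mathcal P_L^{(t)}\circ\mathbf\Pi_L')\omega_\rho\big)(\pi_Lf)=(\mathcal P^t\omega_\rho)(\pi f)=(P^t\omega_p)f.$$
   Context: Let $\Phi^t:X\to X$, $t\in\mathbb R$, be a (measurable) dynamical flow on a completely metrizable, separable space $X$ with an ergodic, invariant, Borel probability measure $\mu$. Put $H=L^2(X,\mu)$, $\langle f,g\rangle=\int_Xf^*g\,d\mu$; $\mathfrak A=L^\infty(X,\mu)$, $\mathfrak A_*=L^1(X,\mu)$; $\mathfrak B=B(H)$, $\mathfrak B_*=B_1(H)$ (trace class). Koopman operators: $U^tf=f\circ\Phi^t$ (on $H$, unitary; also on $\mathfrak A$); $\mathcal U^tA=U^tAU^{t*}$ on $\mathfrak B$. A probability density $p\in\mathfrak A_*$ ($p\ge0$, $\int_X p\,d\mu=1$) induces the normal state $\omega_pf=\int_Xfp\,d\mu$; a density operator $\rho\in\mathfrak B_*$ (positive, trace 1) induces the normal state $\omega_\rho A=\operatorname{tr}(\rho A)$. $S_*(\cdot)$ denotes sets of normal states. Transfer operators: $P^t\omega=\omega\circ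 U^t$, $\mathcal P^t\omega=\omega\circ\mathcal U^t$. $\pi:\mathfrak A\to\mathfrak B$, $(\pi f)g=fg$. $\Gamma(\omega_p)=\omega_\rho$ with $\rho=\langle\sqrt p,\cdot\rangle\sqrt p$. Fix an orthonormal basis $\{\phi_0,\phi_1,\ldots\}$ of $H$ with $\phi_j\in\mathfrak A$; $H_L=\operatorname{span}\{\phi_0,\ldots,\phi_{L-1}\}$; $\Pi_L$ is the orthogonal projection of $H$ onto $H_L$; $\mathfrak B_L=B(H_L)$, identified with $\{\Pi_LA\Pi_L:A\in\mathfrak B\}\subseteq\mathfrak B$; $\mathbf\Pi_LA=\Pi_LA\Pi_L$; $\pi_L=\mathbf\Pi_L\circ\pi$. $U_L^{(t)}=\Pi_LU^t\Pi_L$, $\mathcal U_L^{(t)}A=U_L^{(t)}AU_L^{(t)*}$ on $\mathfrak B_L$, and $\mathcal P_L^{(t)}\omega=\omega\circ\mathcal U_L^{(t)}$ for functionals $\omega$ on $\mathfrak B_L$ (no renormalization). For a density operator $\rho$ and all $L$ large enough that $C_L(\rho)=\operatorname{tr}(\mathbf\Pi_L\rho)>0$, set $\rho_L=\mathbf\Pi_L\rho/C_L(\rho)$ and $\mathbf\Pi'_L\omega_\rho=\omega_{\rho_L}$, a state on $\mathfrak B_L$. *)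

theory Defs
  imports "HOL-Probability.Probability"
begin

text \<open>Elements of \<open>L\<^sup>2\<close> and \<open>L\<^sup>\<infinity>\<close> are represented by complex-valued
  functions, equality being equality almost everywhere; operators act on representatives.
  Objects that are unique only up to null sets, or that matter only on a given space
  (adjoints, densities of states), are picked by \<open>SOME\<close>.\<close>

type_synonym 'a fn = "'a \<Rightarrow> complex"
type_synonym 'a opr = "'a fn \<Rightarrow> 'a fn"


section \<open>Measure-preserving ergodic flows\<close>

text \<open>Only measurability of each time-\<open>t\<close> map is required, not joint measurability
  in \<open>(t, x)\<close>; results under this hypothesis also cover jointly measurable flows.\<close>

definition measurable_flow :: "'a measure \<Rightarrow> (real \<Rightarrow> 'a \<Rightarrow> 'a) \<Rightarrow> bool" where
  "measurable_flow M \<Phi> \<longleftrightarrow>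
     (\<forall>t. \<Phi> t \<in> measurable M M) \<and>
     (\<forall>x\<in>space M. \<Phi> 0 x = x) \<and>
     (\<forall>s t. \<forall>x\<in>space M. \<Phi> (s + t) x = \<Phi> s (\<Phi> t x))"

definition invariant_measure :: "'a measure \<Rightarrow> (real \<Rightarrow> 'a \<Rightarrow> 'a) \<Rightarrow> bool" where
  "invariant_measure M \<Phi> \<longleftrightarrow> (\<forall>t. distr M M (\<Phi> t) = M)"

definition ergodic_flow :: "'a measure \<Rightarrow> (real \<Rightarrow> 'a \<Rightarrow> 'a) \<Rightarrow> bool" where
  "ergodic_flow M \<Phi> \<longleftrightarrow>
     (\<forall>B\<in>sets M. (\<forall>t. \<Phi> t -` B \<inter> space M = B) \<longrightarrow> measure M B = 0 \<or> measure M B = 1)"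


section \<open>The spaces of functions\<close>

definition L2 :: "'a measure \<Rightarrow> 'a fn set" where
  "L2 M = {f \<in> borel_measurable M. integrable M (\<lambda>x. (cmod (f x))\<^sup>2)}"

definition L2_inner :: "'a measure \<Rightarrow> 'a fn \<Rightarrow> 'a fn \<Rightarrow> complex" where
  "L2_inner M f g = (\<integral>x. cnj (f x) * g x \<partial>M)"

definition L2_norm :: "'a measure \<Rightarrow> 'a fn \<Rightarrow> real" where
  "L2_norm M f = sqrt (\<integral>x. (cmod (f x))\<^sup>2 \<partial>M)"

definition Linf :: "'a measure \<Rightarrow> 'a fn set" where
  "Linf M = {f \<in> borel_measurable M. \<exists>C::real. AE x in M. cmod (f x) \<le> C}"

text \<open>\<open>span_upto \<phi> L\<close> is \<open>H\<^sub>L\<close>, the span of the first \<open>L\<close> basis vectors.\<close>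

definition span_upto :: "(nat \<Rightarrow> 'a fn) \<Rightarrow> nat \<Rightarrow> 'a fn set" where
  "span_upto \<phi> L = {f. \<exists>c :: nat \<Rightarrow> complex. f = (\<lambda>x. \<Sum>j<L. c j * \<phi> j x)}"

definition orthonormal_basis :: "'a measure \<Rightarrow> (nat \<Rightarrow> 'a fn) \<Rightarrow> bool" where
  "orthonormal_basis M \<phi> \<longleftrightarrow>
     (\<forall>j. \<phi> j \<in> L2 M) \<and>
     (\<forall>i j. L2_inner M (\<phi> i) (\<phi> j) = (if i = j then 1 else 0)) \<and>
     (\<forall>f\<in>L2 M. \<forall>e>0. \<exists>L. \<exists>g\<in>span_upto \<phi> L. L2_norm M (\<lambda>x. f x - g x) < e)"


section \<open>Operators\<close>

definition bounded_ops :: "'a measure \<Rightarrow> 'a opr set" where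
  "bounded_ops M = {A.
     (\<forall>f\<in>L2 M. A f \<in> L2 M) \<and>
     (\<forall>f\<in>L2 M. \<forall>g\<in>L2 M. (AE x in M. f x = g x) \<longrightarrow> (AE x in M. A f x = A g x)) \<and>
     (\<forall>f\<in>L2 M. \<forall>g\<in>L2 M. \<forall>a b.
        AE x in M. A (\<lambda>y. a * f y + b * g y) x = a * A f x + b * A g x) \<and>
     (\<exists>C. \<forall>f\<in>L2 M. L2_norm M (A f) \<le> C * L2_norm M f)}"

definition adjoint_op :: "'a measure \<Rightarrow> 'a opr \<Rightarrow> 'a opr" where
  "adjoint_op M A = (SOME B. B \<in> bounded_ops M \<and>
     (\<forall>f\<in>L2 M. \<forall>g\<in>L2 M. L2_inner M f (A g) = L2_inner M (B f) g))"

definition positive_op :: "'a measure \<Rightarrow> 'a opr \<Rightarrow> bool" where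
  "positive_op M A \<longleftrightarrow> A \<in> bounded_ops M \<and>
     (\<forall>f\<in>L2 M. Im (L2_inner M f (A f)) = 0 \<and> Re (L2_inner M f (A f)) \<ge> 0)"

text \<open>The trace is computed in the orthonormal basis \<open>\<phi>\<close> fixed throughout; on trace-class
  operators the value does not depend on this choice.\<close>

definition op_trace :: "'a measure \<Rightarrow> (nat \<Rightarrow> 'a fn) \<Rightarrow> 'a opr \<Rightarrow> complex" where
  "op_trace M \<phi> A = (\<Sum>\<^sub>\<infinity>j. L2_inner M (\<phi> j) (A (\<phi> j)))"

text \<open>In the next definition \<open>S\<close> is the absolute value \<open>(A\<^sup>* A)\<^sup>1\<^sup>/\<^sup>2\<close> of \<open>A\<close>.\<close>

definition trace_class :: "'a measure \<Rightarrow> (nat \<Rightarrow> 'a fn) \<Rightarrow> 'a opr \<Rightarrow> bool" where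
  "trace_class M \<phi> A \<longleftrightarrow> A \<in> bounded_ops M \<and>
     (\<exists>S. positive_op M S \<and>
        (\<forall>f\<in>L2 M. AE x in M. S (S f) x = adjoint_op M A (A f) x) \<and>
        (\<lambda>j. L2_inner M (\<phi> j) (S (\<phi> j))) summable_on UNIV)"

definition density_op :: "'a measure \<Rightarrow> (nat \<Rightarrow> 'a fn) \<Rightarrow> 'a opr \<Rightarrow> bool" where
  "density_op M \<phi> \<rho> \<longleftrightarrow> trace_class M \<phi> \<rho> \<and> positive_op M \<rho> \<and> op_trace M \<phi> \<rho> = 1"

definition mult_op :: "'a fn \<Rightarrow> 'a opr" where
  "mult_op f = (\<lambda>g x. f x * g x)"

definition koopman :: "(real \<Rightarrow> 'a \<Rightarrow> 'a) \<Rightarrow> real \<Rightarrow> 'a opr" where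
  "koopman \<Phi> t f = f \<circ> \<Phi> t"

definition koopman_conj ::
    "'a measure \<Rightarrow> (real \<Rightarrow> 'a \<Rightarrow> 'a) \<Rightarrow> real \<Rightarrow> 'a opr \<Rightarrow> 'a opr" where
  "koopman_conj M \<Phi> t A = koopman \<Phi> t \<circ> A \<circ> adjoint_op M (koopman \<Phi> t)"


section \<open>Normal states and transfer operators\<close>

definition prob_density :: "'a measure \<Rightarrow> ('a \<Rightarrow> real) \<Rightarrow> bool" where
  "prob_density M p \<longleftrightarrow> integrable M p \<and> (AE x in M. 0 \<le> p x) \<and> (\<integral>x. p x \<partial>M) = 1"

definition state_fn :: "'a measure \<Rightarrow> ('a \<Rightarrow> real) \<Rightarrow> 'a fn \<Rightarrow> complex" where
  "state_fn M p f = (\<integral>x. f x * complex_of_real (p x) \<partial>M)"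

definition state_op :: "'a measure \<Rightarrow> (nat \<Rightarrow> 'a fn) \<Rightarrow> 'a opr \<Rightarrow> 'a opr \<Rightarrow> complex" where
  "state_op M \<phi> \<rho> A = op_trace M \<phi> (\<rho> \<circ> A)"

text \<open>Functionals on \<open>L\<^sup>\<infinity>\<close> and on the bounded operators are HOL functions whose values outside
  these spaces are irrelevant, hence the bounded quantifiers.\<close>

definition is_density_fn :: "'a measure \<Rightarrow> ('a fn \<Rightarrow> complex) \<Rightarrow> ('a \<Rightarrow> real) \<Rightarrow> bool" where
  "is_density_fn M \<omega> p \<longleftrightarrow> prob_density M p \<and> (\<forall>f\<in>Linf M. \<omega> f = state_fn M p f)"

definition is_density_op ::
    "'a measure \<Rightarrow> (nat \<Rightarrow> 'a fn) \<Rightarrow> ('a opr \<Rightarrow> complex) \<Rightarrow> 'a opr \<Rightarrow> bool" where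
  "is_density_op M \<phi> \<omega> \<rho> \<longleftrightarrow>
     density_op M \<phi> \<rho> \<and> (\<forall>A\<in>bounded_ops M. \<omega> A = state_op M \<phi> \<rho> A)"

definition normal_states_fn :: "'a measure \<Rightarrow> ('a fn \<Rightarrow> complex) set" where
  "normal_states_fn M = {\<omega>. \<exists>p. is_density_fn M \<omega> p}"

definition normal_states_op ::
    "'a measure \<Rightarrow> (nat \<Rightarrow> 'a fn) \<Rightarrow> ('a opr \<Rightarrow> complex) set" where
  "normal_states_op M \<phi> = {\<omega>. \<exists>\<rho>. is_density_op M \<phi> \<omega> \<rho>}"

definition transfer_fn ::
    "(real \<Rightarrow> 'a \<Rightarrow> 'a) \<Rightarrow> real \<Rightarrow> ('a fn \<Rightarrow> complex) \<Rightarrow> ('a fn \<Rightarrow> complex)" where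
  "transfer_fn \<Phi> t \<omega> = \<omega> \<circ> koopman \<Phi> t"

definition transfer_op ::
    "'a measure \<Rightarrow> (real \<Rightarrow> 'a \<Rightarrow> 'a) \<Rightarrow> real \<Rightarrow> ('a opr \<Rightarrow> complex) \<Rightarrow> ('a opr \<Rightarrow> complex)" where
  "transfer_op M \<Phi> t \<omega> = \<omega> \<circ> koopman_conj M \<Phi> t"

text \<open>\<open>state_embedding\<close> is the map \<open>\<Gamma>\<close>, sending the state with density \<open>p\<close> to the pure state
  of \<open>\<langle>\<surd>p, \<cdot>\<rangle> \<surd>p\<close>.\<close>

definition sqrt_projection :: "'a measure \<Rightarrow> ('a \<Rightarrow> real) \<Rightarrow> 'a opr" where
  "sqrt_projection M p =
     (let s = (\<lambda>x. complex_of_real (sqrt (p x))) in (\<lambda>g x. L2_inner M s g * s x))"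

definition state_embedding ::
    "'a measure \<Rightarrow> (nat \<Rightarrow> 'a fn) \<Rightarrow> ('a fn \<Rightarrow> complex) \<Rightarrow> ('a opr \<Rightarrow> complex)" where
  "state_embedding M \<phi> \<omega> = state_op M \<phi> (sqrt_projection M (SOME p. is_density_fn M \<omega> p))"


section \<open>Finite-dimensional projections\<close>

text \<open>Operators on \<open>H\<^sub>L\<close> are identified with operators of the form \<open>\<Pi>\<^sub>L A \<Pi>\<^sub>L\<close> on the whole space;
  under this identification traces and adjoints over \<open>H\<^sub>L\<close> agree with those over \<open>L\<^sup>2\<close>.\<close>

definition orth_proj :: "'a measure \<Rightarrow> 'a fn set \<Rightarrow> 'a opr" where
  "orth_proj M V f = (SOME g. g \<in> V \<and> (\<forall>h\<in>V. L2_inner M h (\<lambda>x. f x - g x) = 0))"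

definition proj_L :: "'a measure \<Rightarrow> (nat \<Rightarrow> 'a fn) \<Rightarrow> nat \<Rightarrow> 'a opr" where
  "proj_L M \<phi> L = orth_proj M (span_upto \<phi> L)"

definition compress :: "'a measure \<Rightarrow> (nat \<Rightarrow> 'a fn) \<Rightarrow> nat \<Rightarrow> 'a opr \<Rightarrow> 'a opr" where
  "compress M \<phi> L A = proj_L M \<phi> L \<circ> A \<circ> proj_L M \<phi> L"

definition mult_op_L :: "'a measure \<Rightarrow> (nat \<Rightarrow> 'a fn) \<Rightarrow> nat \<Rightarrow> 'a fn \<Rightarrow> 'a opr" where
  "mult_op_L M \<phi> L = compress M \<phi> L \<circ> mult_op"

definition koopman_L ::
    "'a measure \<Rightarrow> (nat \<Rightarrow> 'a fn) \<Rightarrow> (real \<Rightarrow> 'a \<Rightarrow> 'a) \<Rightarrow> nat \<Rightarrow> real \<Rightarrow> 'a opr" where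
  "koopman_L M \<phi> \<Phi> L t = compress M \<phi> L (koopman \<Phi> t)"

definition koopman_conj_L ::
    "'a measure \<Rightarrow> (nat \<Rightarrow> 'a fn) \<Rightarrow> (real \<Rightarrow> 'a \<Rightarrow> 'a) \<Rightarrow> nat \<Rightarrow> real \<Rightarrow> 'a opr \<Rightarrow> 'a opr" where
  "koopman_conj_L M \<phi> \<Phi> L t A =
     koopman_L M \<phi> \<Phi> L t \<circ> A \<circ> adjoint_op M (koopman_L M \<phi> \<Phi> L t)"

definition transfer_op_L ::
    "'a measure \<Rightarrow> (nat \<Rightarrow> 'a fn) \<Rightarrow> (real \<Rightarrow> 'a \<Rightarrow> 'a) \<Rightarrow> nat \<Rightarrow> real \<Rightarrow>
     ('a opr \<Rightarrow> complex) \<Rightarrow> ('a opr \<Rightarrow> complex)" where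
  "transfer_op_L M \<phi> \<Phi> L t \<omega> = \<omega> \<circ> koopman_conj_L M \<phi> \<Phi> L t"

text \<open>\<open>normalized_density\<close> is \<open>\<rho>\<^sub>L\<close>; it is meaningful when the trace of \<open>\<Pi>\<^sub>L \<rho> \<Pi>\<^sub>L\<close> is positive,
  i.e. for all large \<open>L\<close> (and is zero otherwise, by division by zero).\<close>

definition normalized_density ::
    "'a measure \<Rightarrow> (nat \<Rightarrow> 'a fn) \<Rightarrow> nat \<Rightarrow> 'a opr \<Rightarrow> 'a opr" where
  "normalized_density M \<phi> L \<rho> =
     (\<lambda>f x. compress M \<phi> L \<rho> f x / op_trace M \<phi> (compress M \<phi> L \<rho>))"

definition project_state ::
    "'a measure \<Rightarrow> (nat \<Rightarrow> 'a fn) \<Rightarrow> nat \<Rightarrow> ('a opr \<Rightarrow> complex) \<Rightarrow> ('a opr \<Rightarrow> complex)" where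
  "project_state M \<phi> L \<omega> =
     state_op M \<phi> (normalized_density M \<phi> L (SOME \<rho>. is_density_op M \<phi> \<omega> \<rho>))"

end

theory Submission
  imports Defs
begin

text \<open>
  Let \<open>X\<^sub>L = U\<^sub>L A\<^sub>L U\<^sub>L\<^sup>*\<close> be the compressed and conjugated observable, and let
  \<open>X = U\<^sup>t A U\<^sup>t\<^sup>*\<close>. The adjoint of \<open>U\<^sup>t\<close> is \<open>U\<^sup>-\<^sup>t\<close> and compression commutes with adjoints, so
  \<open>X\<^sub>L\<close> is a product of compressions of fixed operators. The projections \<open>\<Pi>\<^sub>L\<close> are
  contractions that converge strongly to the identity; hence \<open>X\<^sub>L\<close> converges strongly to \<open>X\<close> and is
  uniformly bounded (\<open>koopman_conj_L_tendsto\<close>). Since \<open>X\<^sub>L\<close> lives on \<open>H\<^sub>L\<close>, the projected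
  state takes on it the value \<open>tr (\<rho> X\<^sub>L) / C\<^sub>L\<close> (\<open>state_op_normalized_density\<close>), where
  \<open>C\<^sub>L = tr (\<Pi>\<^sub>L \<rho> \<Pi>\<^sub>L)\<close> tends to \<open>tr \<rho> = 1\<close>. It remains to see that
  \<open>tr (\<rho> X\<^sub>L)\<close> tends to \<open>tr (\<rho> X)\<close>.

  The trace \<open>\<Sum>\<^sub>j \<langle>\<rho> \<phi>\<^sub>j, X\<^sub>L \<phi>\<^sub>j\<rangle>\<close> is not dominated termwise, because
  \<open>\<Sum>\<^sub>j \<parallel>\<rho> \<phi>\<^sub>j\<parallel>\<close> may diverge. Instead \<open>\<rho>\<close> is decomposed as \<open>\<Sum>\<^sub>k \<langle>g\<^sub>k, \<cdot>\<rangle> g\<^sub>k\<close> with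
  \<open>\<Sum>\<^sub>k \<parallel>g\<^sub>k\<parallel>\<^sup>2 = tr \<rho>\<close>. The spectral theorem would provide this; a Cholesky decomposition
  of the infinite positive matrix of \<open>\<rho>\<close> provides it by elementary means
  (\<open>positive_op_Cholesky\<close>): triangularity makes all matrix entries finite sums.
  Then \<open>tr (\<rho> Y) = \<Sum>\<^sub>k \<langle>g\<^sub>k, Y g\<^sub>k\<rangle>\<close> for every bounded \<open>Y\<close> (\<open>positive_op_trace_formula\<close>), and this series is dominated by
  \<open>\<parallel>Y\<parallel> \<Sum>\<^sub>k \<parallel>g\<^sub>k\<parallel>\<^sup>2\<close>, so strong convergence suffices (\<open>op_trace_strongly_tendsto\<close>).

  For \<open>\<omega>\<^sub>p\<close> with \<open>s = \<surd>p\<close>, the operator \<open>\<langle>s, \<cdot>\<rangle> s\<close> is a density operator, and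
  \<open>U\<^sup>t (\<pi> f) U\<^sup>t\<^sup>*\<close> is multiplication by \<open>f \<circ> \<Phi>\<^sup>t\<close>. Its expectation in the pure state of \<open>s\<close> is
  \<open>\<integral> (f \<circ> \<Phi>\<^sup>t) s\<^sup>2 d\<mu> = \<integral> (f \<circ> \<Phi>\<^sup>t) p d\<mu>\<close>, the value of the classically transferred state at \<open>f\<close>.
\<close>

section \<open>Square-integrable functions\<close>

lemma borel_measurable_cnj [measurable (raw)]:
  "f \<in> borel_measurable M \<Longrightarrow> (\<lambda>x. cnj (f x)) \<in> borel_measurable M"
  by (rule borel_measurable_continuous_on[of cnj, OF _ ]) (auto intro: continuous_intros)

lemma L2_measurable: "f \<in> L2 M \<Longrightarrow> f \<in> borel_measurable M"
  by (simp add: L2_def)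

lemma L2_lincomb:
  assumes "f \<in> L2 M" "g \<in> L2 M"
  shows "(\<lambda>x. a * f x + b * g x) \<in> L2 M"
proof -
  have [measurable]: "f \<in> borel_measurable M" "g \<in> borel_measurable M"
    using assms by (auto simp: L2_def)
  have "integrable M (\<lambda>x. 2 * (cmod a)\<^sup>2 * (cmod (f x))\<^sup>2 + 2 * (cmod b)\<^sup>2 * (cmod (g x))\<^sup>2)"
    using assms by (auto simp: L2_def)
  then have "integrable M (\<lambda>x. (cmod (a * f x + b * g x))\<^sup>2)"
  proof (rule Bochner_Integration.integrable_bound)
    have "(cmod (a * u + b * v))\<^sup>2 \<le> 2 * (cmod a)\<^sup>2 * (cmod u)\<^sup>2 + 2 * (cmod b)\<^sup>2 * (cmod v)\<^sup>2"
      for u v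
    proof -
      have "(cmod (a * u + b * v))\<^sup>2 \<le> (cmod (a * u) + cmod (b * v))\<^sup>2"
        by (intro power_mono norm_triangle_ineq) auto
      also have "\<dots> \<le> 2 * (cmod (a * u))\<^sup>2 + 2 * (cmod (b * v))\<^sup>2"
        using sum_squares_bound[of "cmod (a * u)" "cmod (b * v)"] by (simp add: power2_sum)
      finally show ?thesis
        by (simp add: norm_mult power_mult_distrib)
    qed
    then show "AE x in M. norm ((cmod (a * f x + b * g x))\<^sup>2) \<le>
        norm (2 * (cmod a)\<^sup>2 * (cmod (f x))\<^sup>2 + 2 * (cmod b)\<^sup>2 * (cmod (g x))\<^sup>2)"
      by (intro AE_I2) simp
  qed measurable
  then show ?thesis
    by (simp add: L2_def)
qed

lemma L2_zero: "(\<lambda>x. 0) \<in> L2 M"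
  by (simp add: L2_def)

lemma L2_scale: "f \<in> L2 M \<Longrightarrow> (\<lambda>x. a * f x) \<in> L2 M"
  using L2_lincomb[of f M f a 0] by simp

lemma L2_diff: "f \<in> L2 M \<Longrightarrow> g \<in> L2 M \<Longrightarrow> (\<lambda>x. f x - g x) \<in> L2 M"
  using L2_lincomb[of f M g 1 "-1"] by simp

lemma L2_add: "f \<in> L2 M \<Longrightarrow> g \<in> L2 M \<Longrightarrow> (\<lambda>x. f x + g x) \<in> L2 M"
  using L2_lincomb[of f M g 1 1] by simp

lemma L2_sum: "(\<And>j. j \<in> I \<Longrightarrow> f j \<in> L2 M) \<Longrightarrow> (\<lambda>x. \<Sum>j\<in>I. f j x) \<in> L2 M"
  by (induction I rule: infinite_finite_induct) (auto intro: L2_add simp: L2_zero)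

lemma integrable_inner:
  assumes "f \<in> L2 M" "g \<in> L2 M"
  shows "integrable M (\<lambda>x. cnj (f x) * g x)"
proof -
  have [measurable]: "f \<in> borel_measurable M" "g \<in> borel_measurable M"
    using assms by (auto simp: L2_def)
  have "integrable M (\<lambda>x. (cmod (f x))\<^sup>2 + (cmod (g x))\<^sup>2)"
    using assms by (auto simp: L2_def)
  then show ?thesis
  proof (rule Bochner_Integration.integrable_bound)
    have "cmod u * cmod v \<le> (cmod u)\<^sup>2 + (cmod v)\<^sup>2" for u v
      using sum_squares_bound[of "cmod u" "cmod v"]
        mult_nonneg_nonneg[OF norm_ge_zero[of u] norm_ge_zero[of v]] by linarith
    then show "AE x in M. norm (cnj (f x) * g x) \<le> norm ((cmod (f x))\<^sup>2 + (cmod (g x))\<^sup>2)"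
      by (intro AE_I2) (simp add: norm_mult)
  qed measurable
qed

lemma inner_lincomb_right:
  assumes "h \<in> L2 M" "f \<in> L2 M" "g \<in> L2 M"
  shows "L2_inner M h (\<lambda>x. a * f x + b * g x) = a * L2_inner M h f + b * L2_inner M h g"
proof -
  have "L2_inner M h (\<lambda>x. a * f x + b * g x)
      = (\<integral>x. a * (cnj (h x) * f x) + b * (cnj (h x) * g x) \<partial>M)"
    unfolding L2_inner_def by (rule Bochner_Integration.integral_cong) (auto simp: algebra_simps)
  then show ?thesis
    using assms by (simp add: L2_inner_def integrable_inner)
qed

lemma inner_cnj: "cnj (L2_inner M f g) = L2_inner M g f"
proof -
  have "cnj (L2_inner M f g) = (\<integral>x. cnj (cnj (f x) * g x) \<partial>M)"
    unfolding L2_inner_def by (rule Bochner_Integration.integral_cnj[symmetric])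
  then show ?thesis
    by (simp add: L2_inner_def mult.commute)
qed

lemma inner_lincomb_left:
  assumes "h \<in> L2 M" "f \<in> L2 M" "g \<in> L2 M"
  shows "L2_inner M (\<lambda>x. a * f x + b * g x) h = cnj a * L2_inner M f h + cnj b * L2_inner M g h"
  using arg_cong[OF inner_lincomb_right[OF assms, of a b], of cnj] by (simp add: inner_cnj)

lemma inner_zero [simp]: "L2_inner M h (\<lambda>x. 0) = 0" "L2_inner M (\<lambda>x. 0) h = 0"
  by (simp_all add: L2_inner_def)

lemma inner_scale_right: "L2_inner M h (\<lambda>x. a * f x) = a * L2_inner M h f"
  by (simp add: L2_inner_def mult.left_commute)

lemma inner_scale_left: "L2_inner M (\<lambda>x. a * f x) h = cnj a * L2_inner M f h"
  by (simp add: L2_inner_def mult.assoc)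

lemma inner_diff_right:
  "h \<in> L2 M \<Longrightarrow> f \<in> L2 M \<Longrightarrow> g \<in> L2 M \<Longrightarrow>
    L2_inner M h (\<lambda>x. f x - g x) = L2_inner M h f - L2_inner M h g"
  using inner_lincomb_right[of h M f g 1 "-1"] by simp

lemma inner_AE_cong:
  assumes "f \<in> borel_measurable M" "g \<in> borel_measurable M" "AE x in M. f x = g x"
    and "h \<in> borel_measurable M"
  shows "L2_inner M h f = L2_inner M h g"
proof -
  note [measurable] = assms(1,2,4)
  show ?thesis
    unfolding L2_inner_def using assms(3) by (intro integral_cong_AE) auto
qed

lemma norm_AE_cong:
  assumes "f \<in> L2 M" "g \<in> L2 M" "AE x in M. f x = g x"
  shows "L2_norm M f = L2_norm M g"
  unfolding L2_norm_def using assms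
  by (auto dest!: L2_measurable intro!: arg_cong[where f = sqrt] integral_cong_AE)

lemma norm_nonneg [simp]: "0 \<le> L2_norm M f"
  by (simp add: L2_norm_def)

lemma inner_self: "L2_inner M f f = complex_of_real ((L2_norm M f)\<^sup>2)"
proof -
  have "L2_inner M f f = (\<integral>x. complex_of_real ((cmod (f x))\<^sup>2) \<partial>M)"
    unfolding L2_inner_def
    by (rule Bochner_Integration.integral_cong) (auto simp: complex_norm_square mult.commute simp del: of_real_power)
  then show ?thesis
    by (simp add: L2_norm_def flip: of_real_power)
qed

lemma AE_eq_iff_norm:
  assumes "f \<in> L2 M" "g \<in> L2 M"
  shows "(AE x in M. f x = g x) \<longleftrightarrow> L2_norm M (\<lambda>x. f x - g x) = 0"
proof -
  have "integrable M (\<lambda>x. (cmod (f x - g x))\<^sup>2)"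
    using L2_diff[OF assms] by (simp add: L2_def)
  then show ?thesis
    by (simp add: L2_norm_def integral_nonneg_eq_0_iff_AE)
qed

lemma AE_eq_if_inner_eq:
  assumes "f \<in> L2 M" "g \<in> L2 M" "\<And>h. h \<in> L2 M \<Longrightarrow> L2_inner M h f = L2_inner M h g"
  shows "AE x in M. f x = g x"
proof -
  have d: "(\<lambda>x. f x - g x) \<in> L2 M" (is "?d \<in> _")
    by (rule L2_diff[OF assms(1,2)])
  have "L2_inner M ?d ?d = 0"
    using inner_diff_right[OF d assms(1,2)] assms(3)[OF d] by simp
  then show ?thesis
    by (simp add: AE_eq_iff_norm[OF assms(1,2)] inner_self)
qed

section \<open>Bounded and positive operators\<close>

lemma bounded_ops_L2: "A \<in> bounded_ops M \<Longrightarrow> f \<in> L2 M \<Longrightarrow> A f \<in> L2 M"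
  by (simp add: bounded_ops_def)

lemma bounded_ops_cong:
  "A \<in> bounded_ops M \<Longrightarrow> f \<in> L2 M \<Longrightarrow> g \<in> L2 M \<Longrightarrow> AE x in M. f x = g x \<Longrightarrow>
    AE x in M. A f x = A g x"
  by (simp add: bounded_ops_def)

lemma bounded_ops_lincomb:
  "A \<in> bounded_ops M \<Longrightarrow> f \<in> L2 M \<Longrightarrow> g \<in> L2 M \<Longrightarrow>
    AE x in M. A (\<lambda>y. a * f y + b * g y) x = a * A f x + b * A g x"
  by (simp add: bounded_ops_def)

lemma bounded_ops_bound:
  assumes "A \<in> bounded_ops M"
  obtains C where "C \<ge> 0" "\<And>f. f \<in> L2 M \<Longrightarrow> L2_norm M (A f) \<le> C * L2_norm M f"
proof -
  obtain C where C: "\<forall>f\<in>L2 M. L2_norm M (A f) \<le> C * L2_norm M f"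
    using assms by (auto simp: bounded_ops_def)
  have "L2_norm M (A f) \<le> max C 0 * L2_norm M f" if "f \<in> L2 M" for f
    using C that mult_right_mono[of C "max C 0" "L2_norm M f"] by force
  then show ?thesis
    using that[of "max C 0"] by simp
qed

lemma bounded_op_inner_lincomb:
  assumes "A \<in> bounded_ops M" "h \<in> L2 M" "f \<in> L2 M" "g \<in> L2 M"
  shows "L2_inner M h (A (\<lambda>x. a * f x + b * g x)) = a * L2_inner M h (A f) + b * L2_inner M h (A g)"
proof -
  have "L2_inner M h (A (\<lambda>x. a * f x + b * g x)) = L2_inner M h (\<lambda>x. a * A f x + b * A g x)"
    by (rule inner_AE_cong[OF _ _ bounded_ops_lincomb[OF assms(1,3,4)]])
      (use assms in \<open>simp_all add: L2_measurable bounded_ops_L2 L2_lincomb\<close>)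
  then show ?thesis
    using assms by (simp add: inner_lincomb_right bounded_ops_L2)
qed

lemma bounded_op_inner_zero:
  assumes "A \<in> bounded_ops M" "h \<in> L2 M"
  shows "L2_inner M h (A (\<lambda>x. 0)) = 0"
  using bounded_op_inner_lincomb[OF assms L2_zero L2_zero, of 0 0] by simp

lemma bounded_op_inner_sum:
  assumes "A \<in> bounded_ops M" "h \<in> L2 M" "finite I" "\<And>j. j \<in> I \<Longrightarrow> f j \<in> L2 M"
  shows "L2_inner M h (A (\<lambda>x. \<Sum>j\<in>I. c j * f j x)) = (\<Sum>j\<in>I. c j * L2_inner M h (A (f j)))"
  using assms(3,4)
proof (induction I rule: finite_induct)
  case empty
  then show ?case by (simp add: bounded_op_inner_zero[OF assms(1,2)])
next
  case (insert i I)
  have "(\<lambda>x. \<Sum>j\<in>I. c j * f j x) \<in> L2 M"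
    using insert by (intro L2_sum L2_scale) auto
  then show ?case
    using bounded_op_inner_lincomb[OF assms(1,2), of "f i" "\<lambda>x. \<Sum>j\<in>I. c j * f j x" "c i" 1] insert
    by simp
qed

lemma id_bounded: "(\<lambda>f. f) \<in> bounded_ops M"
  by (auto simp: bounded_ops_def intro!: exI[of _ 1])

lemma positive_opD:
  assumes "positive_op M T"
  shows "T \<in> bounded_ops M" "f \<in> L2 M \<Longrightarrow> Im (L2_inner M f (T f)) = 0"
    "f \<in> L2 M \<Longrightarrow> 0 \<le> Re (L2_inner M f (T f))"
  using assms by (auto simp: positive_op_def)

lemma positive_op_expand:
  assumes "T \<in> bounded_ops M" "f \<in> L2 M" "g \<in> L2 M"
  shows "L2_inner M (\<lambda>x. 1 * f x + z * g x) (T (\<lambda>x. 1 * f x + z * g x)) =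
    L2_inner M f (T f) + z * L2_inner M f (T g) + cnj z * L2_inner M g (T f)
      + cnj z * z * L2_inner M g (T g)"
  using assms L2_lincomb[OF assms(2,3), of 1 z]
  by (simp only: bounded_op_inner_lincomb inner_lincomb_left bounded_ops_L2) (simp add: algebra_simps)

text \<open>Polarization: the form being real at \<open>f + g\<close> and at \<open>f + \<i> g\<close> gives the symmetry of the
  imaginary and of the real part, respectively.\<close>

lemma positive_op_hermitian:
  assumes T: "positive_op M T" and f: "f \<in> L2 M" and g: "g \<in> L2 M"
  shows "L2_inner M f (T g) = L2_inner M (T f) g"
proof -
  have "Im (z * L2_inner M f (T g) + cnj z * L2_inner M g (T f)) = 0" for z
  proof -
    have "Im (L2_inner M f (T f) + z * L2_inner M f (T g) + cnj z * L2_inner M g (T f)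
        + cnj z * z * L2_inner M g (T g)) = 0"
      using positive_opD(2)[OF T L2_lincomb[OF f g, of 1 z]]
      by (simp only: positive_op_expand[OF positive_opD(1)[OF T] f g])
    then show ?thesis
      using positive_opD(2)[OF T f] positive_opD(2)[OF T g] by simp
  qed
  from this[of 1] this[of \<i>] have "L2_inner M f (T g) = cnj (L2_inner M g (T f))"
    by (simp add: complex_eq_iff)
  then show ?thesis by (simp add: inner_cnj)
qed

text \<open>The inequality below is the Cauchy-Schwarz inequality of the form
  \<open>(f, g) \<mapsto> \<langle>f, T g\<rangle>\<close>; the identity operator gives the usual one.\<close>

lemma positive_op_Cauchy_Schwarz:
  assumes T: "positive_op M T" and f: "f \<in> L2 M" and g: "g \<in> L2 M"
  shows "(cmod (L2_inner M f (T g)))\<^sup>2 \<le> Re (L2_inner M f (T f)) * Re (L2_inner M g (T g))"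
proof -
  define a b c where "a = Re (L2_inner M f (T f))" and "b = L2_inner M f (T g)"
    and "c = Re (L2_inner M g (T g))"
  have c0: "c \<ge> 0" using positive_opD(3)[OF T g] by (simp add: c_def)
  have gf: "L2_inner M g (T f) = cnj b"
    using positive_op_hermitian[OF T f g] by (simp add: b_def inner_cnj)
  have cc: "L2_inner M g (T g) = of_real c"
    using positive_opD(2)[OF T g] by (simp add: c_def complex_eq_iff)
  \<comment> \<open>The form is nonnegative at \<open>f - r \<sigma> g\<close> for real \<open>r\<close>, where the factor \<open>\<sigma> = cnj b\<close> makes
    the cross terms real.\<close>
  have q: "0 \<le> a - 2 * r * (cmod b)\<^sup>2 + r\<^sup>2 * (cmod b)\<^sup>2 * c" for r
  proof -
    have "0 \<le> Re (L2_inner M f (T f) + (- of_real r * cnj b) * b + cnj (- of_real r * cnj b) * cnj b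
        + cnj (- of_real r * cnj b) * (- of_real r * cnj b) * of_real c)"
      using positive_opD(3)[OF T L2_lincomb[OF f g, of 1 "- of_real r * cnj b"]]
      by (simp only: positive_op_expand[OF positive_opD(1)[OF T] f g] gf cc b_def)
    then show ?thesis
      by (simp add: a_def cmod_power2) (simp add: algebra_simps power2_eq_square)
  qed
  have "(cmod b)\<^sup>2 \<le> a * c"
  proof (cases "c = 0")
    case True
    have "b = 0"
    proof (rule ccontr)
      assume "b \<noteq> 0"
      then show False using q[of "(a + 1) / (2 * (cmod b)\<^sup>2)"] True by simp
    qed
    then show ?thesis by (simp add: True)
  next
    case False
    with c0 have "c > 0" by simp
    then show ?thesis using q[of "1 / c"] by (simp add: field_simps power2_eq_square)
  qed
  then show ?thesis by (simp add: a_def b_def c_def)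
qed

lemma positive_op_id: "positive_op M (\<lambda>f. f)"
  by (simp add: positive_op_def id_bounded inner_self flip: of_real_power)

lemma Cauchy_Schwarz:
  assumes "f \<in> L2 M" "g \<in> L2 M"
  shows "cmod (L2_inner M f g) \<le> L2_norm M f * L2_norm M g"
proof -
  have "(cmod (L2_inner M f g))\<^sup>2 \<le> (L2_norm M f * L2_norm M g)\<^sup>2"
    using positive_op_Cauchy_Schwarz[OF positive_op_id assms]
    by (simp add: inner_self power_mult_distrib flip: of_real_power)
  then show ?thesis
    by (rule power2_le_imp_le) simp
qed

lemma norm_sq_add:
  assumes "f \<in> L2 M" "g \<in> L2 M"
  shows "(L2_norm M (\<lambda>x. f x + g x))\<^sup>2 =
    (L2_norm M f)\<^sup>2 + 2 * Re (L2_inner M f g) + (L2_norm M g)\<^sup>2"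
proof -
  have "L2_inner M (\<lambda>x. f x + g x) (\<lambda>x. f x + g x) =
      L2_inner M f f + (L2_inner M f g + cnj (L2_inner M f g)) + L2_inner M g g"
    using positive_op_expand[OF id_bounded assms, of 1] by (simp add: inner_cnj)
  from arg_cong[OF this, of Re] show ?thesis
    by (simp add: inner_self flip: of_real_power)
qed

lemma norm_triangle:
  assumes "f \<in> L2 M" "g \<in> L2 M"
  shows "L2_norm M (\<lambda>x. f x + g x) \<le> L2_norm M f + L2_norm M g"
proof -
  have "Re (L2_inner M f g) \<le> L2_norm M f * L2_norm M g"
    using Cauchy_Schwarz[OF assms] complex_Re_le_cmod[of "L2_inner M f g"] by linarith
  then have "(L2_norm M (\<lambda>x. f x + g x))\<^sup>2 \<le> (L2_norm M f + L2_norm M g)\<^sup>2"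
    by (simp add: norm_sq_add[OF assms] power2_sum)
  then show ?thesis
    by (rule power2_le_imp_le) simp
qed

lemma norm_scale: "L2_norm M (\<lambda>x. a * f x) = cmod a * L2_norm M f"
  by (simp add: L2_norm_def norm_mult power_mult_distrib real_sqrt_mult)

section \<open>Expansions in an orthonormal basis\<close>

lemma onb_L2: "orthonormal_basis M \<phi> \<Longrightarrow> \<phi> j \<in> L2 M"
  by (simp add: orthonormal_basis_def)

lemma onb_inner: "orthonormal_basis M \<phi> \<Longrightarrow> L2_inner M (\<phi> i) (\<phi> j) = (if i = j then 1 else 0)"
  by (simp add: orthonormal_basis_def)

lemma onb_span_L2:
  "orthonormal_basis M \<phi> \<Longrightarrow> (\<lambda>x. \<Sum>j<n. c j * \<phi> j x) \<in> L2 M"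
  by (intro L2_sum L2_scale onb_L2)

lemma onb_inner_span:
  assumes "orthonormal_basis M \<phi>"
  shows "L2_inner M (\<phi> i) (\<lambda>x. \<Sum>j<n. c j * \<phi> j x) = (if i < n then c i else 0)"
proof -
  have "L2_inner M (\<phi> i) (\<lambda>x. \<Sum>j<n. c j * \<phi> j x) = (\<Sum>j<n. c j * L2_inner M (\<phi> i) (\<phi> j))"
    using bounded_op_inner_sum[OF id_bounded onb_L2[OF assms], of "{..<n}" \<phi> i c] onb_L2[OF assms]
    by simp
  also have "\<dots> = (\<Sum>j<n. if i = j then c j else 0)"
    by (rule sum.cong) (auto simp: onb_inner[OF assms])
  finally show ?thesis by (simp add: sum.delta)
qed

text \<open>Since the coefficients determine an element of the span as a function, the choice in
  \<open>orth_proj\<close> is unique everywhere and not only up to null sets.\<close>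

lemma proj_L_eq:
  assumes onb: "orthonormal_basis M \<phi>" and f: "f \<in> L2 M"
  shows "proj_L M \<phi> L f = (\<lambda>x. \<Sum>j<L. L2_inner M (\<phi> j) f * \<phi> j x)"
  unfolding proj_L_def orth_proj_def
proof (rule some_equality)
  let ?g = "\<lambda>x. \<Sum>j<L. L2_inner M (\<phi> j) f * \<phi> j x"
  have g: "?g \<in> L2 M" by (rule onb_span_L2[OF onb])
  have orth: "L2_inner M (\<phi> j) (\<lambda>x. f x - ?g x) = 0" if "j < L" for j
    using that by (simp add: inner_diff_right onb_L2[OF onb] f g onb_inner_span[OF onb])
  have "L2_inner M h (\<lambda>x. f x - ?g x) = 0" if h: "h \<in> span_upto \<phi> L" for h
  proof -
    obtain c where h_eq: "h = (\<lambda>x. \<Sum>j<L. c j * \<phi> j x)"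
      using h by (auto simp: span_upto_def)
    let ?d = "\<lambda>x. f x - ?g x"
    have d: "?d \<in> L2 M" by (rule L2_diff[OF f g])
    have "L2_inner M ?d h = (\<Sum>j<L. c j * L2_inner M ?d (\<phi> j))"
      using bounded_op_inner_sum[OF id_bounded d, of "{..<L}" \<phi> c] onb_L2[OF onb] by (simp add: h_eq)
    also have "\<dots> = 0"
    proof (intro sum.neutral ballI)
      fix j assume "j \<in> {..<L}"
      then have "cnj (L2_inner M (\<phi> j) ?d) = 0"
        using orth by simp
      then show "c j * L2_inner M ?d (\<phi> j) = 0"
        unfolding inner_cnj by simp
    qed
    finally have "cnj (L2_inner M ?d h) = 0" by simp
    then show ?thesis unfolding inner_cnj .
  qed
  then show "?g \<in> span_upto \<phi> L \<and> (\<forall>h\<in>span_upto \<phi> L. L2_inner M h (\<lambda>x. f x - ?g x) = 0)"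
    by (auto simp: span_upto_def)
next
  fix g assume g: "g \<in> span_upto \<phi> L \<and> (\<forall>h\<in>span_upto \<phi> L. L2_inner M h (\<lambda>x. f x - g x) = 0)"
  then obtain c where g_eq: "g = (\<lambda>x. \<Sum>j<L. c j * \<phi> j x)"
    by (auto simp: span_upto_def)
  have gL2: "g \<in> L2 M" unfolding g_eq by (rule onb_span_L2[OF onb])
  have "c j = L2_inner M (\<phi> j) f" if "j < L" for j
  proof -
    have "\<phi> j = (\<lambda>x. \<Sum>i<L. (if i = j then 1 else 0) * \<phi> i x)"
      using that by (simp add: sum.delta if_distrib[of "\<lambda>u. u * _"] cong: if_cong)
    then have "\<phi> j \<in> span_upto \<phi> L"
      unfolding span_upto_def by (intro CollectI exI[of _ "\<lambda>i. if i = j then 1 else 0"])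
    then have "L2_inner M (\<phi> j) (\<lambda>x. f x - g x) = 0"
      using g by auto
    moreover have "L2_inner M (\<phi> j) g = c j"
      using that unfolding g_eq by (simp add: onb_inner_span[OF onb])
    ultimately show ?thesis
      by (simp add: inner_diff_right onb_L2[OF onb] f gL2)
  qed
  then show "g = (\<lambda>x. \<Sum>j<L. L2_inner M (\<phi> j) f * \<phi> j x)"
    by (simp add: g_eq)
qed

lemma proj_L_L2: "orthonormal_basis M \<phi> \<Longrightarrow> f \<in> L2 M \<Longrightarrow> proj_L M \<phi> L f \<in> L2 M"
  by (simp add: proj_L_eq onb_span_L2)

lemma inner_basis_proj_L:
  "orthonormal_basis M \<phi> \<Longrightarrow> f \<in> L2 M \<Longrightarrow>
    L2_inner M (\<phi> i) (proj_L M \<phi> L f) = (if i < L then L2_inner M (\<phi> i) f else 0)"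
  by (simp add: proj_L_eq onb_inner_span[of M \<phi>])

lemma proj_L_span:
  assumes "orthonormal_basis M \<phi>" "n \<le> L"
  shows "proj_L M \<phi> L (\<lambda>x. \<Sum>j<n. c j * \<phi> j x) = (\<lambda>x. \<Sum>j<n. c j * \<phi> j x)"
proof
  fix x
  have "(\<Sum>i<L. (if i < n then c i else 0) * \<phi> i x) = (\<Sum>i<n. c i * \<phi> i x)"
    using assms(2) by (intro sum.mono_neutral_cong_right) auto
  then show "proj_L M \<phi> L (\<lambda>x. \<Sum>j<n. c j * \<phi> j x) x = (\<Sum>j<n. c j * \<phi> j x)"
    by (simp add: proj_L_eq[OF assms(1) onb_span_L2[OF assms(1)]] onb_inner_span[OF assms(1)])
qed

lemma proj_L_idem:
  assumes "orthonormal_basis M \<phi>" "f \<in> L2 M"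
  shows "proj_L M \<phi> L (proj_L M \<phi> L f) = proj_L M \<phi> L f"
  using proj_L_span[OF assms(1) order_refl] by (simp add: proj_L_eq assms)

lemma proj_L_basis_beyond:
  "orthonormal_basis M \<phi> \<Longrightarrow> L \<le> j \<Longrightarrow> proj_L M \<phi> L (\<phi> j) = (\<lambda>x. 0)"
  by (simp add: proj_L_eq onb_L2 onb_inner)

lemma proj_L_selfadjoint:
  assumes onb: "orthonormal_basis M \<phi>" and f: "f \<in> L2 M" and g: "g \<in> L2 M"
  shows "L2_inner M f (proj_L M \<phi> L g) = L2_inner M (proj_L M \<phi> L f) g"
proof -
  have ex: "L2_inner M h (proj_L M \<phi> L k) = (\<Sum>j<L. L2_inner M (\<phi> j) k * L2_inner M h (\<phi> j))"
    if "h \<in> L2 M" "k \<in> L2 M" for h k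
    using bounded_op_inner_sum[OF id_bounded that(1), of "{..<L}" \<phi>] onb_L2[OF onb]
    by (simp add: proj_L_eq[OF onb that(2)])
  have "cnj (L2_inner M g (proj_L M \<phi> L f)) = L2_inner M f (proj_L M \<phi> L g)"
    unfolding ex[OF f g] ex[OF g f] by (simp add: inner_cnj mult.commute)
  then show ?thesis by (simp add: inner_cnj)
qed

lemma proj_L_contraction:
  assumes onb: "orthonormal_basis M \<phi>" and f: "f \<in> L2 M"
  shows "L2_norm M (proj_L M \<phi> L f) \<le> L2_norm M f"
proof (cases "L2_norm M (proj_L M \<phi> L f) = 0")
  case False
  let ?P = "proj_L M \<phi> L f"
  have P: "?P \<in> L2 M" by (rule proj_L_L2[OF onb f])
  have "complex_of_real ((L2_norm M ?P)\<^sup>2) = L2_inner M ?P f"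
    using proj_L_selfadjoint[OF onb P f, of L]
    by (simp only: inner_self[symmetric] proj_L_idem[OF onb f])
  then have "(L2_norm M ?P)\<^sup>2 = cmod (L2_inner M ?P f)"
    by (metis norm_of_real abs_of_nonneg zero_le_power2)
  also have "\<dots> \<le> L2_norm M ?P * L2_norm M f"
    by (rule Cauchy_Schwarz[OF P f])
  finally show ?thesis
    using False norm_nonneg[of M ?P] by (simp add: power2_eq_square del: norm_nonneg)
qed simp

lemma proj_L_bounded:
  assumes onb: "orthonormal_basis M \<phi>"
  shows "proj_L M \<phi> L \<in> bounded_ops M"
proof -
  have "AE x in M. proj_L M \<phi> L f x = proj_L M \<phi> L g x"
    if fg: "f \<in> L2 M" "g \<in> L2 M" "AE x in M. f x = g x" for f g
    by (simp add: proj_L_eq onb fg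
        inner_AE_cong[OF L2_measurable L2_measurable fg(3) L2_measurable] onb_L2)
  moreover have "AE x in M. proj_L M \<phi> L (\<lambda>y. a * f y + b * g y) x
      = a * proj_L M \<phi> L f x + b * proj_L M \<phi> L g x"
    if fg: "f \<in> L2 M" "g \<in> L2 M" for f g a b
    by (simp add: proj_L_eq onb fg L2_lincomb inner_lincomb_right onb_L2
        sum_distrib_left sum.distrib algebra_simps)
  ultimately show ?thesis
    unfolding bounded_ops_def
    by (auto simp: proj_L_L2[OF onb] proj_L_contraction[OF onb] intro!: exI[of _ 1])
qed

text \<open>An element \<open>g\<close> of a span is fixed by all later
  projections, so that \<open>\<Pi>\<^sub>L f - f = \<Pi>\<^sub>L (f - g) - (f - g)\<close>, which is at most twice the
  distance of \<open>f\<close> from \<open>g\<close>.\<close>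

lemma proj_L_tendsto:
  assumes onb: "orthonormal_basis M \<phi>" and f: "f \<in> L2 M"
  shows "(\<lambda>L. L2_norm M (\<lambda>x. proj_L M \<phi> L f x - f x)) \<longlonglongrightarrow> 0"
proof (rule LIMSEQ_I)
  fix e :: real assume "e > 0"
  then obtain n g where g: "g \<in> span_upto \<phi> n" "L2_norm M (\<lambda>x. f x - g x) < e / 2"
    using onb f unfolding orthonormal_basis_def by (meson half_gt_zero)
  obtain c where g_eq: "g = (\<lambda>x. \<Sum>j<n. c j * \<phi> j x)"
    using g(1) by (auto simp: span_upto_def)
  have gL2: "g \<in> L2 M" unfolding g_eq by (rule onb_span_L2[OF onb])
  have "L2_norm M (\<lambda>x. proj_L M \<phi> L f x - f x) < e" if "n \<le> L" for L
  proof -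
    let ?P = "proj_L M \<phi> L"
    let ?d = "\<lambda>x. f x - g x"
    have d: "?d \<in> L2 M" by (rule L2_diff[OF f gL2])
    have "?P ?d = (\<lambda>x. ?P f x - ?P g x)"
      by (simp add: proj_L_eq[OF onb] f gL2 d inner_diff_right onb_L2[OF onb] algebra_simps
          sum_subtractf)
    moreover have "?P g = g"
      unfolding g_eq by (rule proj_L_span[OF onb that])
    ultimately have "(\<lambda>x. ?P f x - f x) = (\<lambda>x. ?P ?d x + (- 1) * ?d x)"
      by (auto simp: fun_eq_iff)
    then have "L2_norm M (\<lambda>x. ?P f x - f x) \<le> L2_norm M (?P ?d) + L2_norm M (\<lambda>x. (- 1) * ?d x)"
      using norm_triangle[OF proj_L_L2[OF onb d] L2_scale[OF d, of "- 1"]] by metis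
    also have "\<dots> \<le> L2_norm M ?d + L2_norm M ?d"
      unfolding norm_scale using proj_L_contraction[OF onb d, of L] by simp
    finally show ?thesis using g(2) by simp
  qed
  then show "\<exists>no. \<forall>L\<ge>no. norm (L2_norm M (\<lambda>x. proj_L M \<phi> L f x - f x) - 0) < e"
    by auto
qed

lemma bounded_op_inner_bound:
  assumes "\<And>f. f \<in> L2 M \<Longrightarrow> L2_norm M (X f) \<le> C * L2_norm M f"
    and "X \<in> bounded_ops M" "g \<in> L2 M" "h \<in> L2 M"
  shows "cmod (L2_inner M g (X h)) \<le> C * L2_norm M g * L2_norm M h"
proof -
  have "cmod (L2_inner M g (X h)) \<le> L2_norm M g * L2_norm M (X h)"
    by (intro Cauchy_Schwarz assms(3) bounded_ops_L2[OF assms(2,4)])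
  also have "\<dots> \<le> L2_norm M g * (C * L2_norm M h)"
    by (intro mult_left_mono assms(1,4) norm_nonneg)
  finally show ?thesis by (simp add: mult_ac)
qed

text \<open>The partial sums are \<open>\<langle>g, X \<Pi>\<^sub>n h\<rangle>\<close>.\<close>

lemma basis_expansion_sums:
  assumes onb: "orthonormal_basis M \<phi>" and X: "X \<in> bounded_ops M"
    and g: "g \<in> L2 M" and h: "h \<in> L2 M"
  shows "(\<lambda>j. L2_inner M (\<phi> j) h * L2_inner M g (X (\<phi> j))) sums L2_inner M g (X h)"
proof -
  obtain C where C: "\<And>f. f \<in> L2 M \<Longrightarrow> L2_norm M (X f) \<le> C * L2_norm M f"
    using bounded_ops_bound[OF X] by metis
  let ?s = "\<lambda>n. \<Sum>j<n. L2_inner M (\<phi> j) h * L2_inner M g (X (\<phi> j))"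
  have bd: "cmod (?s n - L2_inner M g (X h))
      \<le> C * L2_norm M g * L2_norm M (\<lambda>x. proj_L M \<phi> n h x - h x)" for n
  proof -
    have P: "proj_L M \<phi> n h \<in> L2 M" by (rule proj_L_L2[OF onb h])
    have "?s n = L2_inner M g (X (proj_L M \<phi> n h))"
      using onb_L2[OF onb] by (simp add: proj_L_eq[OF onb h] bounded_op_inner_sum[OF X g])
    then have "?s n - L2_inner M g (X h) = L2_inner M g (X (\<lambda>x. proj_L M \<phi> n h x - h x))"
      using bounded_op_inner_lincomb[OF X g P h, of 1 "- 1"] by simp
    then show ?thesis
      using bounded_op_inner_bound[OF C X g L2_diff[OF P h]] by simp
  qed
  have lim: "(\<lambda>n. C * L2_norm M g * L2_norm M (\<lambda>x. proj_L M \<phi> n h x - h x)) \<longlonglongrightarrow> 0"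
    using tendsto_mult_right_zero[OF proj_L_tendsto[OF onb h]] by simp
  have "(\<lambda>n. ?s n - L2_inner M g (X h)) \<longlonglongrightarrow> 0"
    by (rule Lim_null_comparison[OF always_eventually[OF allI[OF bd]] lim])
  then show ?thesis
    unfolding sums_def by (rule LIM_zero_cancel)
qed

lemma Parseval:
  assumes onb: "orthonormal_basis M \<phi>" and g: "g \<in> L2 M"
  shows "(\<lambda>j. (cmod (L2_inner M (\<phi> j) g))\<^sup>2) sums (L2_norm M g)\<^sup>2"
proof -
  have "(\<lambda>j. complex_of_real ((cmod (L2_inner M (\<phi> j) g))\<^sup>2)) sums complex_of_real ((L2_norm M g)\<^sup>2)"
  proof -
    have "L2_inner M (\<phi> j) g * L2_inner M g (\<phi> j) = of_real ((cmod (L2_inner M (\<phi> j) g))\<^sup>2)" for j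
      unfolding complex_norm_square inner_cnj ..
    then show ?thesis
      using basis_expansion_sums[OF onb id_bounded g g] unfolding inner_self by simp
  qed
  then show ?thesis
    unfolding sums_of_real_iff .
qed

text \<open>The coefficients \<open>\<langle>g, X \<phi>\<^sub>j\<rangle>\<close> are those of \<open>X\<^sup>* g\<close>. Testing against the finite combination
  of the basis with the conjugate coefficients gives Bessel's inequality for them directly from
  the bound on \<open>X\<close>.\<close>

lemma adjoint_Bessel:
  assumes onb: "orthonormal_basis M \<phi>" and X: "X \<in> bounded_ops M" and g: "g \<in> L2 M"
    and C: "\<And>f. f \<in> L2 M \<Longrightarrow> L2_norm M (X f) \<le> C * L2_norm M f"
  shows "(\<Sum>j<n. (cmod (L2_inner M g (X (\<phi> j))))\<^sup>2) \<le> C\<^sup>2 * (L2_norm M g)\<^sup>2"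
proof -
  define a where "a j = L2_inner M g (X (\<phi> j))" for j
  define s where "s = (\<Sum>j<n. (cmod (a j))\<^sup>2)"
  define h where "h = (\<lambda>x. \<Sum>j<n. cnj (a j) * \<phi> j x)"
  have hL2: "h \<in> L2 M" unfolding h_def by (rule onb_span_L2[OF onb])
  have s0: "s \<ge> 0" by (simp add: s_def sum_nonneg)
  have s_cplx: "complex_of_real s = (\<Sum>j<n. cnj (a j) * a j)"
    unfolding s_def of_real_sum complex_norm_square by (simp add: mult.commute)
  have "L2_inner M g (X h) = complex_of_real s"
    unfolding h_def s_cplx using onb_L2[OF onb] by (simp add: bounded_op_inner_sum[OF X g] a_def)
  then have le: "s \<le> C * L2_norm M g * L2_norm M h"
    using bounded_op_inner_bound[OF C X g hL2] s0 by simp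
  have "L2_inner M h h = (\<Sum>j<n. cnj (a j) * L2_inner M h (\<phi> j))"
    using bounded_op_inner_sum[OF id_bounded hL2, of "{..<n}" \<phi> "\<lambda>j. cnj (a j)"] onb_L2[OF onb]
    by (simp add: h_def)
  also have "\<dots> = (\<Sum>j<n. cnj (a j) * a j)"
  proof (rule sum.cong)
    fix j assume "j \<in> {..<n}"
    then have "cnj (L2_inner M (\<phi> j) h) = a j"
      by (simp add: h_def onb_inner_span[OF onb])
    then show "cnj (a j) * L2_inner M h (\<phi> j) = cnj (a j) * a j"
      by (simp add: inner_cnj)
  qed simp
  finally have "complex_of_real ((L2_norm M h)\<^sup>2) = complex_of_real s"
    by (simp only: inner_self s_cplx)
  then have h_norm: "(L2_norm M h)\<^sup>2 = s" by (simp only: of_real_eq_iff)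
  have "s \<le> C\<^sup>2 * (L2_norm M g)\<^sup>2"
  proof (cases "s = 0")
    case False
    have "s * s \<le> (C * L2_norm M g * L2_norm M h)\<^sup>2"
      using le s0 by (simp add: power2_eq_square mult_mono')
    also have "\<dots> = C\<^sup>2 * (L2_norm M g)\<^sup>2 * s"
      by (simp add: power_mult_distrib h_norm)
    finally show ?thesis using False s0 by simp
  qed simp
  then show ?thesis by (simp add: s_def a_def)
qed

text \<open>The bound depends on \<open>g\<close> only through its squared norm; it is what makes the double series
  of the trace formula absolutely convergent.\<close>

lemma basis_expansion_abs_summable:
  assumes onb: "orthonormal_basis M \<phi>" and X: "X \<in> bounded_ops M" and g: "g \<in> L2 M"
    and C: "\<And>f. f \<in> L2 M \<Longrightarrow> L2_norm M (X f) \<le> C * L2_norm M f"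
  defines "a \<equiv> \<lambda>j. L2_inner M (\<phi> j) g * L2_inner M g (X (\<phi> j))"
  shows "summable (\<lambda>j. cmod (a j))" "(\<Sum>j. cmod (a j)) \<le> (1 + C\<^sup>2) * (L2_norm M g)\<^sup>2"
proof -
  have bd: "(\<Sum>j<n. cmod (a j)) \<le> (1 + C\<^sup>2) * (L2_norm M g)\<^sup>2" for n
  proof -
    have "(\<Sum>j<n. cmod (a j))
        \<le> (\<Sum>j<n. (cmod (L2_inner M (\<phi> j) g))\<^sup>2 + (cmod (L2_inner M g (X (\<phi> j))))\<^sup>2)"
    proof (rule sum_mono)
      fix j
      have "u * v \<le> u\<^sup>2 + v\<^sup>2" if "u \<ge> 0" "v \<ge> 0" for u v :: real
        using sum_squares_bound[of u v] mult_nonneg_nonneg[OF that] by linarith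
      then show "cmod (a j) \<le> (cmod (L2_inner M (\<phi> j) g))\<^sup>2 + (cmod (L2_inner M g (X (\<phi> j))))\<^sup>2"
        by (simp add: a_def norm_mult)
    qed
    also have "\<dots> \<le> (L2_norm M g)\<^sup>2 + C\<^sup>2 * (L2_norm M g)\<^sup>2"
    proof -
      have "(\<Sum>j<n. (cmod (L2_inner M (\<phi> j) g))\<^sup>2) \<le> (L2_norm M g)\<^sup>2"
        using sum_le_suminf[OF sums_summable[OF Parseval[OF onb g]], of "{..<n}"]
          sums_unique[OF Parseval[OF onb g]] by simp
      then show ?thesis
        using adjoint_Bessel[OF onb X g C, of n] by (simp add: sum.distrib)
    qed
    finally show ?thesis by (simp add: algebra_simps)
  qed
  show "summable (\<lambda>j. cmod (a j))"
    by (rule summableI_nonneg_bounded[OF _ bd]) simp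
  then show "(\<Sum>j. cmod (a j)) \<le> (1 + C\<^sup>2) * (L2_norm M g)\<^sup>2"
    by (rule suminf_le_const[OF _ bd])
qed

lemma basis_expansion_has_sum:
  assumes onb: "orthonormal_basis M \<phi>" and X: "X \<in> bounded_ops M" and g: "g \<in> L2 M"
  shows "((\<lambda>j. L2_inner M (\<phi> j) g * L2_inner M g (X (\<phi> j))) has_sum L2_inner M g (X g)) UNIV"
proof -
  obtain C where C: "\<And>f. f \<in> L2 M \<Longrightarrow> L2_norm M (X f) \<le> C * L2_norm M f"
    using bounded_ops_bound[OF X] by metis
  show ?thesis
    by (rule norm_summable_imp_has_sum[OF basis_expansion_abs_summable(1)[OF onb X g C]
          basis_expansion_sums[OF onb X g g]])
qed

section \<open>Cholesky decomposition and the trace formula\<close>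

text \<open>One Cholesky step: subtracting from \<open>T\<close> the rank one operator that makes the remainder
  vanish at \<open>e\<close>. If \<open>\<langle>e, T e\<rangle> = 0\<close> then division by zero leaves \<open>T\<close> as it is, which is right
  because \<open>T e\<close> is then null.\<close>

definition deflate :: "'a measure \<Rightarrow> 'a fn \<Rightarrow> 'a opr \<Rightarrow> 'a opr" where
  "deflate M e T = (\<lambda>f x. T f x - L2_inner M (T e) f / L2_inner M e (T e) * T e x)"

lemma inner_deflate:
  assumes "T \<in> bounded_ops M" "e \<in> L2 M" "h \<in> L2 M" "f \<in> L2 M"
  shows "L2_inner M h (deflate M e T f)
    = L2_inner M h (T f) - L2_inner M (T e) f / L2_inner M e (T e) * L2_inner M h (T e)"
  using inner_lincomb_right[OF assms(3) bounded_ops_L2[OF assms(1,4)] bounded_ops_L2[OF assms(1,2)],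
      of 1 "- (L2_inner M (T e) f / L2_inner M e (T e))"]
  by (simp add: deflate_def)

lemma deflate_bounded:
  assumes T: "T \<in> bounded_ops M" and e: "e \<in> L2 M"
  shows "deflate M e T \<in> bounded_ops M"
proof -
  note Te = bounded_ops_L2[OF T e]
  define c where "c f = L2_inner M (T e) f / L2_inner M e (T e)" for f
  have d: "deflate M e T f = (\<lambda>x. 1 * T f x + (- c f) * T e x)" for f
    by (simp add: deflate_def c_def)
  have "AE x in M. deflate M e T f x = deflate M e T g x"
    if fg: "f \<in> L2 M" "g \<in> L2 M" "AE x in M. f x = g x" for f g
  proof -
    have "c f = c g"
      unfolding c_def using fg Te by (simp add: inner_AE_cong[OF _ _ fg(3)] L2_measurable)
    then show ?thesis
      using bounded_ops_cong[OF T fg] by (simp add: d)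
  qed
  moreover have "AE x in M. deflate M e T (\<lambda>y. a * f y + b * g y) x
      = a * deflate M e T f x + b * deflate M e T g x"
    if fg: "f \<in> L2 M" "g \<in> L2 M" for f g a b
  proof -
    have "c (\<lambda>y. a * f y + b * g y) = a * c f + b * c g"
      unfolding c_def by (simp add: inner_lincomb_right[OF Te fg] add_divide_distrib)
    then show ?thesis
      using bounded_ops_lincomb[OF T fg, of a b]
      by (auto simp: d algebra_simps elim!: eventually_mono)
  qed
  moreover have "\<exists>C. \<forall>f\<in>L2 M. L2_norm M (deflate M e T f) \<le> C * L2_norm M f"
  proof -
    obtain C where C: "\<And>f. f \<in> L2 M \<Longrightarrow> L2_norm M (T f) \<le> C * L2_norm M f"
      using bounded_ops_bound[OF T] by metis
    define K where "K = L2_norm M (T e) / cmod (L2_inner M e (T e))"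
    have "L2_norm M (deflate M e T f) \<le> (C + K * L2_norm M (T e)) * L2_norm M f"
      if f: "f \<in> L2 M" for f
    proof -
      have "L2_norm M (deflate M e T f) \<le> L2_norm M (T f) + cmod (c f) * L2_norm M (T e)"
        using norm_triangle[OF bounded_ops_L2[OF T f] L2_scale[OF Te, of "- c f"]]
        by (simp only: d norm_scale mult_1 norm_minus_cancel)
      moreover have "cmod (c f) \<le> K * L2_norm M f"
        using divide_right_mono[OF Cauchy_Schwarz[OF Te f], of "cmod (L2_inner M e (T e))"]
        by (simp add: c_def K_def norm_divide)
      then have "cmod (c f) * L2_norm M (T e) \<le> K * L2_norm M f * L2_norm M (T e)"
        by (intro mult_right_mono) auto
      ultimately show ?thesis
        using C[OF f] by (simp add: algebra_simps)
    qed
    then show ?thesis by blast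
  qed
  moreover have "deflate M e T f \<in> L2 M" if "f \<in> L2 M" for f
    unfolding d by (intro L2_lincomb bounded_ops_L2[OF T that] Te)
  ultimately show ?thesis
    by (simp add: bounded_ops_def)
qed

text \<open>Positivity of the remainder is exactly the Cauchy-Schwarz inequality for the form of \<open>T\<close>.\<close>

lemma deflate_positive:
  assumes T: "positive_op M T" and e: "e \<in> L2 M"
  shows "positive_op M (deflate M e T)"
proof -
  note Tb = positive_opD(1)[OF T]
  define c where "c = Re (L2_inner M e (T e))"
  have c: "L2_inner M e (T e) = of_real c" "c \<ge> 0"
    using positive_opD[OF T] e by (auto simp: c_def complex_eq_iff)
  have "Im (L2_inner M f (deflate M e T f)) = 0 \<and> 0 \<le> Re (L2_inner M f (deflate M e T f))"
    if f: "f \<in> L2 M" for f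
  proof -
    define q where "q = Re (L2_inner M f (T f))"
    have q: "L2_inner M f (T f) = of_real q" "q \<ge> 0"
      using positive_opD[OF T] f by (auto simp: q_def complex_eq_iff)
    define b where "b = L2_inner M f (T e)"
    have "cnj b * b = of_real ((cmod b)\<^sup>2)"
      unfolding complex_norm_square by (rule mult.commute)
    then have eq: "L2_inner M f (deflate M e T f) = of_real (q - (cmod b)\<^sup>2 / c)"
      using inner_deflate[OF Tb e f f] inner_cnj[of M f "T e"] by (simp add: q c b_def)
    have "(cmod b)\<^sup>2 \<le> q * c"
      using positive_op_Cauchy_Schwarz[OF T f e] by (simp add: q_def c_def b_def)
    then have "(cmod b)\<^sup>2 / c \<le> q"
      using c(2) q(2) by (cases "c = 0") (auto simp: field_simps)
    then show ?thesis unfolding eq by simp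
  qed
  then show ?thesis
    unfolding positive_op_def using deflate_bounded[OF Tb e] by blast
qed

lemma deflate_null:
  assumes T: "positive_op M T" and e: "e \<in> L2 M" and h: "h \<in> L2 M"
  shows "L2_inner M h (deflate M e T e) = 0"
proof (cases "L2_inner M e (T e) = 0")
  case True
  then have "(cmod (L2_inner M h (T e)))\<^sup>2 \<le> 0"
    using positive_op_Cauchy_Schwarz[OF T h e] by simp
  then show ?thesis
    using True by (simp add: inner_deflate[OF positive_opD(1)[OF T] e h e])
next
  case False
  then show ?thesis
    using positive_op_hermitian[OF T e e]
    by (simp add: inner_deflate[OF positive_opD(1)[OF T] e h e])
qed

lemma deflate_keeps_null:
  assumes T: "positive_op M T" and e: "e \<in> L2 M" and f: "f \<in> L2 M" and h: "h \<in> L2 M"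
    and null: "\<And>h. h \<in> L2 M \<Longrightarrow> L2_inner M h (T f) = 0"
  shows "L2_inner M h (deflate M e T f) = 0"
  using positive_op_hermitian[OF T e f] null[OF e] null[OF h]
  by (simp add: inner_deflate[OF positive_opD(1)[OF T] e h f])

text \<open>Dividing \<open>T e\<close> by the square root of \<open>\<langle>e, T e\<rangle>\<close> turns the subtracted operator into
  \<open>\<langle>g, \<cdot>\<rangle> g\<close>.\<close>

lemma deflate_rank_one:
  assumes T: "positive_op M T" and e: "e \<in> L2 M" and h: "h \<in> L2 M" and f: "f \<in> L2 M"
  defines "g \<equiv> \<lambda>x. complex_of_real (1 / sqrt (Re (L2_inner M e (T e)))) * T e x"
  shows "L2_inner M h (T f) = L2_inner M h g * L2_inner M g f + L2_inner M h (deflate M e T f)"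
proof -
  define c where "c = Re (L2_inner M e (T e))"
  have c: "L2_inner M e (T e) = of_real c" "c \<ge> 0"
    using positive_opD[OF T] e by (auto simp: c_def complex_eq_iff)
  define r where "r = complex_of_real (1 / sqrt c)"
  have "r * r = of_real (1 / sqrt c * (1 / sqrt c))"
    unfolding r_def by (rule of_real_mult[symmetric])
  then have rr: "r * r = 1 / of_real c"
    using c(2) by simp
  have "L2_inner M h g * L2_inner M g f = (r * r) * (L2_inner M h (T e) * L2_inner M (T e) f)"
    unfolding g_def c_def[symmetric] r_def[symmetric] inner_scale_left inner_scale_right
    by (simp add: r_def)
  then show ?thesis
    unfolding inner_deflate[OF positive_opD(1)[OF T] e h f] rr c(1) by simp
qed

primrec cholesky_remainder :: "'a measure \<Rightarrow> (nat \<Rightarrow> 'a fn) \<Rightarrow> 'a opr \<Rightarrow> nat \<Rightarrow> 'a opr" where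
  "cholesky_remainder M \<phi> T 0 = T"
| "cholesky_remainder M \<phi> T (Suc k) = deflate M (\<phi> k) (cholesky_remainder M \<phi> T k)"

text \<open>The matrix \<open>\<langle>\<phi>\<^sub>j, g\<^sub>k\<rangle>\<close> below is lower triangular, so that every matrix entry of \<open>T\<close> in the
  basis is a finite sum, and no convergence is at stake yet.\<close>

lemma positive_op_Cholesky:
  fixes \<phi> :: "nat \<Rightarrow> 'a fn"
  assumes T: "positive_op M T" and onb: "\<And>j. \<phi> j \<in> L2 M"
  shows "\<exists>g. (\<forall>k. g k \<in> L2 M) \<and> (\<forall>j k. j < k \<longrightarrow> L2_inner M (g k) (\<phi> j) = 0) \<and>
    (\<forall>j. \<forall>h\<in>L2 M.
      L2_inner M h (T (\<phi> j)) = (\<Sum>k\<le>j. L2_inner M h (g k) * L2_inner M (g k) (\<phi> j)))"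
proof -
  define R where "R = cholesky_remainder M \<phi> T"
  have R_Suc: "R (Suc k) = deflate M (\<phi> k) (R k)" for k by (simp add: R_def)
  have R: "positive_op M (R k)" for k
    by (induction k) (simp_all add: R_def T deflate_positive onb)
  have null: "L2_inner M h (R n (\<phi> j)) = 0" if "j < n" "h \<in> L2 M" for j n h
    using that
  proof (induction n arbitrary: h)
    case (Suc n)
    show ?case
    proof (cases "j = n")
      case True
      then show ?thesis
        using deflate_null[OF R onb Suc.prems(2)] by (simp add: R_Suc)
    next
      case False
      then have "j < n" using Suc.prems(1) by simp
      from Suc.IH[OF this] show ?thesis
        unfolding R_Suc by (rule deflate_keeps_null[OF R onb onb Suc.prems(2)])
    qed
  qed simp
  define g where "g k = (\<lambda>x. complex_of_real (1 / sqrt (Re (L2_inner M (\<phi> k) (R k (\<phi> k)))))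
    * R k (\<phi> k) x)" for k
  have g: "g k \<in> L2 M" for k
    unfolding g_def by (intro L2_scale bounded_ops_L2[OF positive_opD(1)[OF R]] onb)
  have tri: "L2_inner M (g k) (\<phi> j) = 0" if "j < k" for j k
    unfolding g_def inner_scale_left
    using null[OF that onb[of k]] positive_op_hermitian[OF R[of k] onb[of k] onb[of j]] by simp
  have expand: "L2_inner M h (T f) =
      (\<Sum>k<n. L2_inner M h (g k) * L2_inner M (g k) f) + L2_inner M h (R n f)"
    if "h \<in> L2 M" "f \<in> L2 M" for h f n
  proof (induction n)
    case (Suc n)
    then show ?case
      using deflate_rank_one[OF R[of n] onb[of n] that] by (simp add: R_Suc g_def)
  qed (simp add: R_def)
  have "L2_inner M h (T (\<phi> j)) = (\<Sum>k\<le>j. L2_inner M h (g k) * L2_inner M (g k) (\<phi> j))"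
    if "h \<in> L2 M" for h j
    using expand[OF that onb, of j "Suc j"] null[OF _ that, of j "Suc j"]
    by (simp add: lessThan_Suc_atMost)
  then show ?thesis
    using g tri by (intro exI[of _ g]) simp
qed

lemma Parseval_has_sum:
  assumes "orthonormal_basis M \<phi>" "g \<in> L2 M"
  shows "((\<lambda>j. (cmod (L2_inner M (\<phi> j) g))\<^sup>2) has_sum (L2_norm M g)\<^sup>2) UNIV"
proof (rule norm_summable_imp_has_sum)
  show "summable (\<lambda>j. norm ((cmod (L2_inner M (\<phi> j) g))\<^sup>2))"
    using sums_summable[OF Parseval[OF assms]] by simp
qed (rule Parseval[OF assms])

text \<open>The trace of \<open>T X\<close> is a double series over the Cholesky factors and the basis.
  The square-summability of the factors makes it absolutely convergent, and summing
  over the basis first leaves a series dominated by \<open>\<parallel>X\<parallel> \<parallel>g\<^sub>k\<parallel>\<^sup>2\<close>.\<close>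

lemma positive_op_trace_formula:
  assumes T: "positive_op M T" and onb: "orthonormal_basis M \<phi>"
    and trace: "(\<lambda>j. L2_inner M (\<phi> j) (T (\<phi> j))) summable_on UNIV"
  shows "\<exists>g. (\<forall>k. g k \<in> L2 M) \<and> summable (\<lambda>k. (L2_norm M (g k))\<^sup>2) \<and>
    (\<forall>X\<in>bounded_ops M.
      ((\<lambda>j. L2_inner M (\<phi> j) (T (X (\<phi> j)))) has_sum (\<Sum>k. L2_inner M (g k) (X (g k)))) UNIV)"
proof -
  note \<phi> = onb_L2[OF onb]
  obtain g where "(\<forall>k. g k \<in> L2 M) \<and> (\<forall>j k. j < k \<longrightarrow> L2_inner M (g k) (\<phi> j) = 0) \<and>
    (\<forall>j. \<forall>h\<in>L2 M.
      L2_inner M h (T (\<phi> j)) = (\<Sum>k\<le>j. L2_inner M h (g k) * L2_inner M (g k) (\<phi> j)))"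
    using positive_op_Cholesky[of M T \<phi>, OF T \<phi>] by (rule exE)
  then have g: "\<And>k. g k \<in> L2 M"
    and tri: "\<And>j k. j < k \<Longrightarrow> L2_inner M (g k) (\<phi> j) = 0"
    and chol: "\<And>j h. h \<in> L2 M \<Longrightarrow>
      L2_inner M h (T (\<phi> j)) = (\<Sum>k\<le>j. L2_inner M h (g k) * L2_inner M (g k) (\<phi> j))"
    by simp_all
  have tri': "L2_inner M (\<phi> j) (g k) = 0" if "j < k" for j k
    using arg_cong[OF tri[OF that], of cnj] by (simp add: inner_cnj)
  \<comment> \<open>Summing \<open>b\<close> over \<open>k\<close> gives the diagonal of \<open>T\<close>, summing over \<open>j\<close> gives \<open>\<parallel>g\<^sub>k\<parallel>\<^sup>2\<close>.\<close>
  define b where "b = (\<lambda>(j, k). (cmod (L2_inner M (\<phi> j) (g k)))\<^sup>2)"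
  have "b summable_on (UNIV \<times> UNIV)"
  proof (rule summable_on_SigmaI)
    fix j
    have "complex_of_real (\<Sum>k\<le>j. b (j, k)) = L2_inner M (\<phi> j) (T (\<phi> j))"
      unfolding chol[OF \<phi>] b_def of_real_sum prod.case complex_norm_square inner_cnj ..
    from arg_cong[OF this, of Re]
    have "(\<Sum>k\<le>j. b (j, k)) = Re (L2_inner M (\<phi> j) (T (\<phi> j)))"
      by (simp only: Re_complex_of_real)
    then show "((\<lambda>k. b (j, k)) has_sum Re (L2_inner M (\<phi> j) (T (\<phi> j)))) UNIV"
      by (intro has_sum_finite_neutralI[of "{..j}"]) (simp_all add: b_def tri')
  next
    show "(\<lambda>j. Re (L2_inner M (\<phi> j) (T (\<phi> j)))) summable_on UNIV"
      using trace by (rule summable_on_Re)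
  qed (auto simp: b_def)
  then have b_swap: "(\<lambda>(k, j). b (j, k)) summable_on (UNIV \<times> UNIV)"
    by (rule summable_on_swap[THEN iffD1])
  have "((\<lambda>j. b (j, k)) has_sum (L2_norm M (g k))\<^sup>2) UNIV" for k
    using Parseval_has_sum[OF onb g] by (simp add: b_def)
  then have "(\<lambda>k. (L2_norm M (g k))\<^sup>2) summable_on UNIV"
    using has_sum_SigmaD[OF has_sum_infsum[OF b_swap], of "\<lambda>k. (L2_norm M (g k))\<^sup>2"]
    by (auto simp: summable_on_def)
  then have sq: "summable (\<lambda>k. (L2_norm M (g k))\<^sup>2)"
    by (rule summable_on_imp_summable)
  have "((\<lambda>j. L2_inner M (\<phi> j) (T (X (\<phi> j)))) has_sum (\<Sum>k. L2_inner M (g k) (X (g k)))) UNIV"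
    if X: "X \<in> bounded_ops M" for X
  proof -
    obtain C where C: "\<And>f. f \<in> L2 M \<Longrightarrow> L2_norm M (X f) \<le> C * L2_norm M f"
      using bounded_ops_bound[OF X] by metis
    \<comment> \<open>Summing \<open>a\<close> over \<open>k\<close> gives \<open>\<langle>\<phi>\<^sub>j, T X \<phi>\<^sub>j\<rangle>\<close>, summing over \<open>j\<close> gives \<open>\<langle>g\<^sub>k, X g\<^sub>k\<rangle>\<close>.\<close>
    define a where "a = (\<lambda>(k, j). L2_inner M (\<phi> j) (g k) * L2_inner M (g k) (X (\<phi> j)))"
    have sm: "summable (\<lambda>j. cmod (a (k, j)))"
      and le: "(\<Sum>j. cmod (a (k, j))) \<le> (1 + C\<^sup>2) * (L2_norm M (g k))\<^sup>2" for k
      using basis_expansion_abs_summable[OF onb X g C] by (simp_all add: a_def)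
    have "(\<lambda>p. cmod (a p)) summable_on (UNIV \<times> UNIV)"
    proof (rule summable_on_SigmaI)
      fix k
      show "((\<lambda>j. cmod (a (k, j))) has_sum (\<Sum>j. cmod (a (k, j)))) UNIV"
        by (rule norm_summable_imp_has_sum) (use sm in \<open>auto intro: summable_sums\<close>)
    next
      have "summable (\<lambda>k. \<Sum>j. cmod (a (k, j)))"
      proof (rule summable_comparison_test')
        show "summable (\<lambda>k. (1 + C\<^sup>2) * (L2_norm M (g k))\<^sup>2)"
          by (rule summable_mult[OF sq])
        show "norm (\<Sum>j. cmod (a (k, j))) \<le> (1 + C\<^sup>2) * (L2_norm M (g k))\<^sup>2" for k
          using le[of k] suminf_nonneg[OF sm[of k]] by simp
      qed
      then show "(\<lambda>k. \<Sum>j. cmod (a (k, j))) summable_on UNIV"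
        by (subst summable_on_UNIV_nonneg_real_iff) (use suminf_nonneg[OF sm] in auto)
    qed simp
    then have a_sum: "(a has_sum infsum a (UNIV \<times> UNIV)) (UNIV \<times> UNIV)"
      by (rule has_sum_infsum[OF abs_summable_summable])
    have "((\<lambda>j. a (k, j)) has_sum L2_inner M (g k) (X (g k))) UNIV" for k
      using basis_expansion_has_sum[OF onb X g] by (simp add: a_def)
    then have "((\<lambda>k. L2_inner M (g k) (X (g k))) has_sum infsum a (UNIV \<times> UNIV)) UNIV"
      by (rule has_sum_SigmaD[OF a_sum])
    then have trace_eq: "(\<Sum>k. L2_inner M (g k) (X (g k))) = infsum a (UNIV \<times> UNIV)"
      by (rule sums_unique[OF has_sum_imp_sums, symmetric])
    have row: "L2_inner M (\<phi> j) (T (X (\<phi> j))) = (\<Sum>k\<le>j. a (k, j))" for j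
    proof -
      have X\<phi>: "X (\<phi> j) \<in> L2 M" by (rule bounded_ops_L2[OF X \<phi>])
      have "L2_inner M (\<phi> j) (T (X (\<phi> j))) = cnj (L2_inner M (X (\<phi> j)) (T (\<phi> j)))"
        unfolding positive_op_hermitian[OF T \<phi> X\<phi>] inner_cnj ..
      also have "\<dots> = (\<Sum>k\<le>j. a (k, j))"
        by (simp add: chol[OF X\<phi>] a_def inner_cnj mult.commute)
      finally show ?thesis .
    qed
    have swapped: "((\<lambda>(j, k). a (k, j)) has_sum infsum a (UNIV \<times> UNIV)) (UNIV \<times> UNIV)"
      using a_sum by (rule has_sum_swap[THEN iffD1])
    have "((\<lambda>k. a (k, j)) has_sum L2_inner M (\<phi> j) (T (X (\<phi> j)))) UNIV" for j
      unfolding row by (rule has_sum_finite_neutralI[of "{..j}"]) (simp_all add: a_def tri')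
    then show ?thesis
      unfolding trace_eq by (intro has_sum_SigmaD[OF swapped]) simp
  qed
  then show ?thesis
    using g sq by (intro exI[of _ g]) simp
qed

section \<open>Strong convergence\<close>

lemma bounded_ops_comp:
  assumes A: "A \<in> bounded_ops M" and B: "B \<in> bounded_ops M"
  shows "A \<circ> B \<in> bounded_ops M"
proof -
  note BL = bounded_ops_L2[OF B]
  have "AE x in M. A (B (\<lambda>y. a * f y + b * g y)) x = a * A (B f) x + b * A (B g) x"
    if fg: "f \<in> L2 M" "g \<in> L2 M" for f g a b
    using bounded_ops_cong[OF A BL[OF L2_lincomb[OF fg]] L2_lincomb[OF BL[OF fg(1)] BL[OF fg(2)]]
        bounded_ops_lincomb[OF B fg, of a b]]
      bounded_ops_lincomb[OF A BL[OF fg(1)] BL[OF fg(2)], of a b]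
    by eventually_elim simp
  moreover have "AE x in M. A (B f) x = A (B g) x"
    if fg: "f \<in> L2 M" "g \<in> L2 M" "AE x in M. f x = g x" for f g
    by (rule bounded_ops_cong[OF A BL[OF fg(1)] BL[OF fg(2)] bounded_ops_cong[OF B fg]])
  moreover have "\<exists>C. \<forall>f\<in>L2 M. L2_norm M (A (B f)) \<le> C * L2_norm M f"
  proof -
    obtain C where C: "C \<ge> 0" "\<And>f. f \<in> L2 M \<Longrightarrow> L2_norm M (A f) \<le> C * L2_norm M f"
      using bounded_ops_bound[OF A] by metis
    obtain D where D: "D \<ge> 0" "\<And>f. f \<in> L2 M \<Longrightarrow> L2_norm M (B f) \<le> D * L2_norm M f"
      using bounded_ops_bound[OF B] by metis
    have "L2_norm M (A (B f)) \<le> (C * D) * L2_norm M f" if "f \<in> L2 M" for f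
      using C(2)[OF BL[OF that]] mult_left_mono[OF D(2)[OF that] C(1)] by (simp add: mult.assoc)
    then show ?thesis by blast
  qed
  ultimately show ?thesis
    using bounded_ops_L2[OF A BL] by (simp add: bounded_ops_def)
qed

lemma bounded_op_null:
  assumes A: "A \<in> bounded_ops M" and f: "f \<in> L2 M" "AE x in M. f x = 0"
  shows "AE x in M. A f x = 0"
proof -
  have "AE x in M. A (\<lambda>y. 0) x = 0"
    using bounded_ops_lincomb[OF A L2_zero L2_zero, of 0 0] by simp
  moreover have "AE x in M. A f x = A (\<lambda>y. 0) x"
    by (rule bounded_ops_cong[OF A f(1) L2_zero f(2)])
  ultimately show ?thesis by eventually_elim simp
qed

lemma bounded_op_norm_diff:
  assumes A: "A \<in> bounded_ops M" and f: "f \<in> L2 M" and g: "g \<in> L2 M"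
  shows "L2_norm M (\<lambda>x. A f x - A g x) = L2_norm M (A (\<lambda>x. f x - g x))"
proof (rule norm_AE_cong)
  show "AE x in M. A f x - A g x = A (\<lambda>x. f x - g x) x"
    using bounded_ops_lincomb[OF A f g, of 1 "- 1"] by eventually_elim simp
qed (intro L2_diff bounded_ops_L2[OF A] f g)+

text \<open>Uniform boundedness is made part of strong convergence; it makes products converge, and
  it provides the dominating series for traces.\<close>

definition strongly_tendsto :: "'a measure \<Rightarrow> (nat \<Rightarrow> 'a opr) \<Rightarrow> 'a opr \<Rightarrow> bool" where
  "strongly_tendsto M A X \<longleftrightarrow> (\<forall>n. A n \<in> bounded_ops M) \<and> X \<in> bounded_ops M \<and>
     (\<exists>C\<ge>0. \<forall>n. \<forall>f\<in>L2 M. L2_norm M (A n f) \<le> C * L2_norm M f) \<and>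
     (\<forall>f\<in>L2 M. (\<lambda>n. L2_norm M (\<lambda>x. A n f x - X f x)) \<longlonglongrightarrow> 0)"

lemma strongly_tendsto_const:
  assumes "X \<in> bounded_ops M"
  shows "strongly_tendsto M (\<lambda>n. X) X"
proof -
  obtain C where "C \<ge> 0" "\<And>f. f \<in> L2 M \<Longrightarrow> L2_norm M (X f) \<le> C * L2_norm M f"
    using bounded_ops_bound[OF assms] by metis
  then have "\<exists>C\<ge>0. \<forall>f\<in>L2 M. L2_norm M (X f) \<le> C * L2_norm M f"
    by blast
  then show ?thesis
    using assms by (simp add: strongly_tendsto_def L2_norm_def)
qed

lemma strongly_tendsto_proj_L:
  assumes "orthonormal_basis M \<phi>"
  shows "strongly_tendsto M (proj_L M \<phi>) (\<lambda>f. f)"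
  using proj_L_bounded[OF assms] proj_L_contraction[OF assms] proj_L_tendsto[OF assms] id_bounded
  by (auto simp: strongly_tendsto_def intro!: exI[of _ 1])

lemma strongly_tendsto_comp:
  assumes "strongly_tendsto M A X" "strongly_tendsto M B Y"
  shows "strongly_tendsto M (\<lambda>n. A n \<circ> B n) (X \<circ> Y)"
proof -
  have A: "A n \<in> bounded_ops M" and B: "B n \<in> bounded_ops M" for n
    using assms by (simp_all add: strongly_tendsto_def)
  have X: "X \<in> bounded_ops M" and Y: "Y \<in> bounded_ops M"
    using assms by (simp_all add: strongly_tendsto_def)
  obtain C where C: "C \<ge> 0" "\<And>n f. f \<in> L2 M \<Longrightarrow> L2_norm M (A n f) \<le> C * L2_norm M f"
    using assms(1) unfolding strongly_tendsto_def by blast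
  obtain D where D: "D \<ge> 0" "\<And>n f. f \<in> L2 M \<Longrightarrow> L2_norm M (B n f) \<le> D * L2_norm M f"
    using assms(2) unfolding strongly_tendsto_def by blast
  have limA: "f \<in> L2 M \<Longrightarrow> (\<lambda>n. L2_norm M (\<lambda>x. A n f x - X f x)) \<longlonglongrightarrow> 0" for f
    using assms(1) by (simp add: strongly_tendsto_def)
  have limB: "f \<in> L2 M \<Longrightarrow> (\<lambda>n. L2_norm M (\<lambda>x. B n f x - Y f x)) \<longlonglongrightarrow> 0" for f
    using assms(2) by (simp add: strongly_tendsto_def)
  have "L2_norm M (A n (B n f)) \<le> (C * D) * L2_norm M f" if "f \<in> L2 M" for n f
    using C(2)[OF bounded_ops_L2[OF B that], of n n] mult_left_mono[OF D(2)[OF that, of n] C(1)]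
    by (simp add: mult.assoc)
  then have bound: "\<exists>K\<ge>0. \<forall>n. \<forall>f\<in>L2 M. L2_norm M (A n (B n f)) \<le> K * L2_norm M f"
    using C(1) D(1) by (intro exI[of _ "C * D"]) simp
  have lim: "(\<lambda>n. L2_norm M (\<lambda>x. A n (B n f) x - X (Y f) x)) \<longlonglongrightarrow> 0" if f: "f \<in> L2 M" for f
  proof (rule Lim_null_comparison)
    note Bf = bounded_ops_L2[OF B f]
    note Yf = bounded_ops_L2[OF Y f]
    show "\<forall>\<^sub>F n in sequentially. norm (L2_norm M (\<lambda>x. A n (B n f) x - X (Y f) x))
        \<le> C * L2_norm M (\<lambda>x. B n f x - Y f x) + L2_norm M (\<lambda>x. A n (Y f) x - X (Y f) x)"
    proof (intro always_eventually allI)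
      fix n
      have "L2_norm M (\<lambda>x. A n (B n f) x - X (Y f) x) \<le>
          L2_norm M (\<lambda>x. A n (B n f) x - A n (Y f) x) + L2_norm M (\<lambda>x. A n (Y f) x - X (Y f) x)"
        using norm_triangle[OF
            L2_diff[OF bounded_ops_L2[OF A[of n] Bf[of n]] bounded_ops_L2[OF A[of n] Yf]]
            L2_diff[OF bounded_ops_L2[OF A[of n] Yf] bounded_ops_L2[OF X Yf]]] by simp
      also have "L2_norm M (\<lambda>x. A n (B n f) x - A n (Y f) x) \<le> C * L2_norm M (\<lambda>x. B n f x - Y f x)"
        unfolding bounded_op_norm_diff[OF A Bf Yf] by (intro C(2) L2_diff Bf Yf)
      finally show "norm (L2_norm M (\<lambda>x. A n (B n f) x - X (Y f) x))
          \<le> C * L2_norm M (\<lambda>x. B n f x - Y f x) + L2_norm M (\<lambda>x. A n (Y f) x - X (Y f) x)"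
        by simp
    qed
    show "(\<lambda>n. C * L2_norm M (\<lambda>x. B n f x - Y f x)
        + L2_norm M (\<lambda>x. A n (Y f) x - X (Y f) x)) \<longlonglongrightarrow> 0"
      using tendsto_add[OF tendsto_mult_right_zero[OF limB[OF f], of C] limA[OF Yf]] by simp
  qed
  show ?thesis
    unfolding strongly_tendsto_def
    using bounded_ops_comp[OF A B] bounded_ops_comp[OF X Y] bound lim by simp
qed

lemma strongly_tendsto_cong:
  assumes "strongly_tendsto M A X" and B: "\<And>n. B n \<in> bounded_ops M" and Y: "Y \<in> bounded_ops M"
    and AB: "\<And>n f. f \<in> L2 M \<Longrightarrow> AE x in M. B n f x = A n f x"
    and XY: "\<And>f. f \<in> L2 M \<Longrightarrow> AE x in M. Y f x = X f x"
  shows "strongly_tendsto M B Y"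
proof -
  have A: "A n \<in> bounded_ops M" and X: "X \<in> bounded_ops M" for n
    using assms(1) by (simp_all add: strongly_tendsto_def)
  have "L2_norm M (B n f) = L2_norm M (A n f)" if "f \<in> L2 M" for n f
    using that by (intro norm_AE_cong AB bounded_ops_L2[OF A] bounded_ops_L2[OF B])
  moreover have "L2_norm M (\<lambda>x. B n f x - Y f x) = L2_norm M (\<lambda>x. A n f x - X f x)"
    if f: "f \<in> L2 M" for n f
  proof (rule norm_AE_cong)
    show "AE x in M. B n f x - Y f x = A n f x - X f x"
      using AB[OF f, of n] XY[OF f] by eventually_elim simp
  qed (intro L2_diff bounded_ops_L2[OF A f] bounded_ops_L2[OF B f] bounded_ops_L2[OF X f]
      bounded_ops_L2[OF Y f])+
  ultimately show ?thesis
    using assms(1) B Y by (simp add: strongly_tendsto_def)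
qed

lemma strongly_tendsto_compress:
  assumes "orthonormal_basis M \<phi>" "A \<in> bounded_ops M"
  shows "strongly_tendsto M (\<lambda>L. compress M \<phi> L A) A"
proof -
  have "strongly_tendsto M (\<lambda>L. proj_L M \<phi> L \<circ> A \<circ> proj_L M \<phi> L) ((\<lambda>f. f) \<circ> A \<circ> (\<lambda>f. f))"
    by (intro strongly_tendsto_comp strongly_tendsto_proj_L strongly_tendsto_const assms)
  then show ?thesis
    by (simp add: compress_def comp_def)
qed

lemma compress_bounded:
  "orthonormal_basis M \<phi> \<Longrightarrow> A \<in> bounded_ops M \<Longrightarrow> compress M \<phi> L A \<in> bounded_ops M"
  unfolding compress_def by (intro bounded_ops_comp proj_L_bounded)

text \<open>For a fixed trace class operator, the trace of the product is continuous for strong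
  convergence of the other factor, by dominated convergence in the trace formula.\<close>

lemma op_trace_strongly_tendsto:
  assumes T: "positive_op M T" and onb: "orthonormal_basis M \<phi>"
    and trace: "(\<lambda>j. L2_inner M (\<phi> j) (T (\<phi> j))) summable_on UNIV"
    and lim: "strongly_tendsto M A X"
  shows "(\<lambda>n. op_trace M \<phi> (T \<circ> A n)) \<longlonglongrightarrow> op_trace M \<phi> (T \<circ> X)"
proof -
  obtain g where "(\<forall>k. g k \<in> L2 M) \<and> summable (\<lambda>k. (L2_norm M (g k))\<^sup>2) \<and>
    (\<forall>X\<in>bounded_ops M.
      ((\<lambda>j. L2_inner M (\<phi> j) (T (X (\<phi> j)))) has_sum (\<Sum>k. L2_inner M (g k) (X (g k)))) UNIV)"
    using positive_op_trace_formula[OF T onb trace] by (rule exE)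
  then have g: "\<And>k. g k \<in> L2 M" and sq: "summable (\<lambda>k. (L2_norm M (g k))\<^sup>2)"
    and formula: "\<And>X. X \<in> bounded_ops M \<Longrightarrow>
      ((\<lambda>j. L2_inner M (\<phi> j) (T (X (\<phi> j)))) has_sum (\<Sum>k. L2_inner M (g k) (X (g k)))) UNIV"
    by simp_all
  have tr: "op_trace M \<phi> (T \<circ> Y) = (\<Sum>k. L2_inner M (g k) (Y (g k)))" if "Y \<in> bounded_ops M" for Y
    using infsumI[OF formula[OF that]] by (simp add: op_trace_def)
  have A: "A n \<in> bounded_ops M" and X: "X \<in> bounded_ops M" for n
    using lim by (simp_all add: strongly_tendsto_def)
  obtain C where C: "C \<ge> 0" "\<And>n f. f \<in> L2 M \<Longrightarrow> L2_norm M (A n f) \<le> C * L2_norm M f"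
    using lim unfolding strongly_tendsto_def by blast
  have "(\<lambda>n. L2_inner M (g k) (A n (g k))) \<longlonglongrightarrow> L2_inner M (g k) (X (g k))" for k
  proof (rule LIM_zero_cancel, rule Lim_null_comparison[OF always_eventually[OF allI]])
    fix n
    show "norm (L2_inner M (g k) (A n (g k)) - L2_inner M (g k) (X (g k)))
        \<le> L2_norm M (g k) * L2_norm M (\<lambda>x. A n (g k) x - X (g k) x)"
      using Cauchy_Schwarz[OF g L2_diff[OF bounded_ops_L2[OF A g] bounded_ops_L2[OF X g]], of k n k k]
      by (simp add: inner_diff_right[OF g bounded_ops_L2[OF A g] bounded_ops_L2[OF X g]])
  next
    have "(\<lambda>n. L2_norm M (\<lambda>x. A n (g k) x - X (g k) x)) \<longlonglongrightarrow> 0"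
      using lim g by (simp add: strongly_tendsto_def)
    then show "(\<lambda>n. L2_norm M (g k) * L2_norm M (\<lambda>x. A n (g k) x - X (g k) x)) \<longlonglongrightarrow> 0"
      by (rule tendsto_mult_right_zero)
  qed
  moreover have "\<forall>\<^sub>F (k, n) in sequentially \<times>\<^sub>F sequentially.
      norm (L2_inner M (g k) (A n (g k))) \<le> C * (L2_norm M (g k))\<^sup>2"
  proof (intro always_eventually allI, clarify)
    fix k n
    show "norm (L2_inner M (g k) (A n (g k))) \<le> C * (L2_norm M (g k))\<^sup>2"
      using bounded_op_inner_bound[OF C(2) A g g, of k n k] by (simp add: power2_eq_square)
  qed
  ultimately have "(\<lambda>n. \<Sum>k. L2_inner M (g k) (A n (g k))) \<longlonglongrightarrow> (\<Sum>k. L2_inner M (g k) (X (g k)))"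
    using tannerys_theorem[of "\<lambda>k n. L2_inner M (g k) (A n (g k))"
        "\<lambda>k. L2_inner M (g k) (X (g k))" sequentially "\<lambda>k. C * (L2_norm M (g k))\<^sup>2"]
      summable_mult[OF sq] by simp
  then show ?thesis
    by (simp add: tr A X)
qed

section \<open>Adjoints and the Koopman operators\<close>

text \<open>Adjoints are unique up to null sets, so an explicit one determines what \<open>adjoint_op\<close>
  chooses.\<close>

lemma adjoint_op_eq:
  assumes B: "B \<in> bounded_ops M" and A: "\<And>g. g \<in> L2 M \<Longrightarrow> A g \<in> L2 M"
    and adj: "\<And>f g. f \<in> L2 M \<Longrightarrow> g \<in> L2 M \<Longrightarrow> L2_inner M f (A g) = L2_inner M (B f) g"
  shows "adjoint_op M A \<in> bounded_ops M"
    and "f \<in> L2 M \<Longrightarrow> AE x in M. adjoint_op M A f x = B f x"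
proof -
  let ?P = "\<lambda>B. B \<in> bounded_ops M \<and>
     (\<forall>f\<in>L2 M. \<forall>g\<in>L2 M. L2_inner M f (A g) = L2_inner M (B f) g)"
  have "?P B" using B adj by blast
  then have P: "?P (adjoint_op M A)"
    unfolding adjoint_op_def by (rule someI[of ?P])
  then show bd: "adjoint_op M A \<in> bounded_ops M" by blast
  assume f: "f \<in> L2 M"
  show "AE x in M. adjoint_op M A f x = B f x"
  proof (rule AE_eq_if_inner_eq[OF bounded_ops_L2[OF bd f] bounded_ops_L2[OF B f]])
    fix h assume h: "h \<in> L2 M"
    have "L2_inner M (adjoint_op M A f) h = L2_inner M (B f) h"
      using P adj[OF f h] f h by simp
    then have "cnj (L2_inner M (adjoint_op M A f) h) = cnj (L2_inner M (B f) h)"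
      by simp
    then show "L2_inner M h (adjoint_op M A f) = L2_inner M h (B f)"
      unfolding inner_cnj .
  qed
qed

text \<open>The projections are self-adjoint, so compression commutes with taking adjoints.\<close>

lemma compress_adjoint:
  assumes onb: "orthonormal_basis M \<phi>" and A: "A \<in> bounded_ops M" and B: "B \<in> bounded_ops M"
    and adj: "\<And>f g. f \<in> L2 M \<Longrightarrow> g \<in> L2 M \<Longrightarrow> L2_inner M f (A g) = L2_inner M (B f) g"
    and f: "f \<in> L2 M" and g: "g \<in> L2 M"
  shows "L2_inner M f (compress M \<phi> L A g) = L2_inner M (compress M \<phi> L B f) g"
  using f g by (simp add: compress_def proj_L_selfadjoint[OF onb] adj proj_L_L2[OF onb]
      bounded_ops_L2[OF A] bounded_ops_L2[OF B])

lemma flow_AE: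
  assumes "measurable_flow M \<Phi>" "invariant_measure M \<Phi>" "AE x in M. P x"
  shows "AE x in M. P (\<Phi> t x)"
proof -
  have meas: "\<Phi> t \<in> measurable M M" and inv: "distr M M (\<Phi> t) = M"
    using assms(1,2) by (simp_all add: measurable_flow_def invariant_measure_def)
  show ?thesis
    using AE_distrD[OF meas, of P] assms(3) unfolding inv by blast
qed

lemma flow_integral:
  fixes h :: "'a \<Rightarrow> 'b::{banach, second_countable_topology}"
  assumes "measurable_flow M \<Phi>" "invariant_measure M \<Phi>" "h \<in> borel_measurable M"
  shows "(\<integral>x. h (\<Phi> t x) \<partial>M) = (\<integral>x. h x \<partial>M)"
  using integral_distr[of "\<Phi> t" M M h] assms by (simp add: measurable_flow_def invariant_measure_def)

lemma flow_inverse: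
  assumes "measurable_flow M \<Phi>" "x \<in> space M"
  shows "\<Phi> (- t) (\<Phi> t x) = x"
proof -
  have "\<Phi> (- t + t) x = \<Phi> (- t) (\<Phi> t x)"
    using assms unfolding measurable_flow_def by blast
  then show ?thesis using assms by (simp add: measurable_flow_def)
qed

lemma koopman_L2:
  assumes "measurable_flow M \<Phi>" "invariant_measure M \<Phi>" "f \<in> L2 M"
  shows "koopman \<Phi> t f \<in> L2 M"
proof -
  have [measurable]: "\<Phi> t \<in> measurable M M" "f \<in> borel_measurable M"
    using assms by (simp_all add: measurable_flow_def L2_def)
  have "integrable (distr M M (\<Phi> t)) (\<lambda>x. (cmod (f x))\<^sup>2)"
    using assms by (simp add: invariant_measure_def L2_def)
  then have "integrable M (\<lambda>x. (cmod (f (\<Phi> t x)))\<^sup>2)"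
    by (rule integrable_distr[rotated]) simp
  then show ?thesis
    by (simp add: L2_def koopman_def comp_def)
qed

lemma koopman_bounded:
  assumes "measurable_flow M \<Phi>" "invariant_measure M \<Phi>"
  shows "koopman \<Phi> t \<in> bounded_ops M"
proof -
  have "L2_norm M (koopman \<Phi> t f) = L2_norm M f" if "f \<in> L2 M" for f
  proof -
    have [measurable]: "f \<in> borel_measurable M" using that by (rule L2_measurable)
    show ?thesis
      using flow_integral[OF assms, of "\<lambda>x. (cmod (f x))\<^sup>2" t]
      by (simp add: L2_norm_def koopman_def)
  qed
  moreover have "AE x in M. koopman \<Phi> t f x = koopman \<Phi> t g x" if "AE x in M. f x = g x" for f g
    using flow_AE[OF assms that] by (simp add: koopman_def)
  moreover have "koopman \<Phi> t (\<lambda>y. a * f y + b * g y) = (\<lambda>x. a * koopman \<Phi> t f x + b * koopman \<Phi> t g x)"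
    for f g a b
    by (simp add: koopman_def comp_def)
  ultimately show ?thesis
    using koopman_L2[OF assms, of _ t] by (auto simp: bounded_ops_def intro!: exI[of _ 1])
qed

text \<open>Invariance of the measure substitutes \<open>\<Phi>\<^sup>t x\<close> for the integration variable.\<close>

lemma koopman_adjoint:
  assumes "measurable_flow M \<Phi>" "invariant_measure M \<Phi>" "f \<in> L2 M" "g \<in> L2 M"
  shows "L2_inner M f (koopman \<Phi> t g) = L2_inner M (koopman \<Phi> (- t) f) g"
proof -
  have [measurable]: "koopman \<Phi> (- t) f \<in> borel_measurable M" "g \<in> borel_measurable M"
    using assms koopman_L2 L2_measurable by blast+
  have "L2_inner M f (koopman \<Phi> t g) = (\<integral>x. cnj (koopman \<Phi> (- t) f (\<Phi> t x)) * g (\<Phi> t x) \<partial>M)"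
    unfolding L2_inner_def
    by (rule Bochner_Integration.integral_cong) (simp_all add: koopman_def flow_inverse[OF assms(1)])
  also have "\<dots> = L2_inner M (koopman \<Phi> (- t) f) g"
    unfolding L2_inner_def
    by (rule flow_integral[OF assms(1,2), of "\<lambda>x. cnj (koopman \<Phi> (- t) f x) * g x"]) simp
  finally show ?thesis .
qed

lemma adjoint_koopman:
  assumes flow: "measurable_flow M \<Phi>" "invariant_measure M \<Phi>"
  shows "adjoint_op M (koopman \<Phi> t) \<in> bounded_ops M"
    and "f \<in> L2 M \<Longrightarrow> AE x in M. adjoint_op M (koopman \<Phi> t) f x = koopman \<Phi> (- t) f x"
  by (rule adjoint_op_eq[OF koopman_bounded[OF flow] koopman_L2[OF flow] koopman_adjoint[OF flow]];
      assumption)+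

lemma koopman_conj_bounded:
  assumes "measurable_flow M \<Phi>" "invariant_measure M \<Phi>" "A \<in> bounded_ops M"
  shows "koopman_conj M \<Phi> t A \<in> bounded_ops M"
  unfolding koopman_conj_def
  by (intro bounded_ops_comp koopman_bounded adjoint_koopman(1) assms)

lemma adjoint_koopman_L:
  assumes flow: "measurable_flow M \<Phi>" "invariant_measure M \<Phi>" and onb: "orthonormal_basis M \<phi>"
  shows "adjoint_op M (koopman_L M \<phi> \<Phi> L t) \<in> bounded_ops M"
    and "f \<in> L2 M \<Longrightarrow> AE x in M. adjoint_op M (koopman_L M \<phi> \<Phi> L t) f x
      = compress M \<phi> L (koopman \<Phi> (- t)) f x"
proof -
  note U = koopman_bounded[OF flow]
  have adj: "L2_inner M f (koopman_L M \<phi> \<Phi> L t g) = L2_inner M (compress M \<phi> L (koopman \<Phi> (- t)) f) g"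
    if "f \<in> L2 M" "g \<in> L2 M" for f g
    unfolding koopman_L_def by (rule compress_adjoint[OF onb U U koopman_adjoint[OF flow] that])
  have L2: "koopman_L M \<phi> \<Phi> L t g \<in> L2 M" if "g \<in> L2 M" for g
    unfolding koopman_L_def by (rule bounded_ops_L2[OF compress_bounded[OF onb U] that])
  show "adjoint_op M (koopman_L M \<phi> \<Phi> L t) \<in> bounded_ops M"
    by (rule adjoint_op_eq(1)[OF compress_bounded[OF onb U] L2 adj])
  show "f \<in> L2 M \<Longrightarrow> AE x in M. adjoint_op M (koopman_L M \<phi> \<Phi> L t) f x
      = compress M \<phi> L (koopman \<Phi> (- t)) f x"
    by (rule adjoint_op_eq(2)[OF compress_bounded[OF onb U] L2 adj])
qed

text \<open>Adjoints are not continuous for strong convergence in general. Here they converge because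
  the adjoint of a compressed Koopman operator is again a compression, that of the inverse
  Koopman operator.\<close>

lemma koopman_conj_L_tendsto:
  assumes flow: "measurable_flow M \<Phi>" "invariant_measure M \<Phi>" and onb: "orthonormal_basis M \<phi>"
    and A: "A \<in> bounded_ops M"
  shows "strongly_tendsto M (\<lambda>L. koopman_conj_L M \<phi> \<Phi> L t (compress M \<phi> L A)) (koopman_conj M \<Phi> t A)"
proof -
  note U = koopman_bounded[OF flow]
  have "strongly_tendsto M (\<lambda>L. adjoint_op M (koopman_L M \<phi> \<Phi> L t)) (adjoint_op M (koopman \<Phi> t))"
    by (rule strongly_tendsto_cong[OF strongly_tendsto_compress[OF onb U[of "- t"]]
          adjoint_koopman_L(1)[OF flow onb] adjoint_koopman(1)[OF flow]
          adjoint_koopman_L(2)[OF flow onb] adjoint_koopman(2)[OF flow]])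
  then show ?thesis
    unfolding koopman_conj_L_def koopman_conj_def koopman_L_def
    by (intro strongly_tendsto_comp strongly_tendsto_compress onb U A)
qed

section \<open>Density operators\<close>

text \<open>A divergent diagonal would have trace \<open>0\<close> by convention, so the trace being \<open>1\<close> already
  says that the diagonal is summable.\<close>

lemma density_op_trace_has_sum:
  assumes "density_op M \<phi> \<rho>"
  shows "((\<lambda>j. L2_inner M (\<phi> j) (\<rho> (\<phi> j))) has_sum 1) UNIV"
proof -
  have one: "infsum (\<lambda>j. L2_inner M (\<phi> j) (\<rho> (\<phi> j))) UNIV = 1"
    using assms by (simp add: density_op_def op_trace_def)
  then have "(\<lambda>j. L2_inner M (\<phi> j) (\<rho> (\<phi> j))) summable_on UNIV"
    using infsum_not_exists by fastforce
  then show ?thesis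
    using has_sum_infsum one by metis
qed

lemma op_trace_compress:
  assumes onb: "orthonormal_basis M \<phi>" and T: "T \<in> bounded_ops M"
  shows "op_trace M \<phi> (compress M \<phi> L T) = (\<Sum>j<L. L2_inner M (\<phi> j) (T (\<phi> j)))"
proof -
  note \<phi> = onb_L2[OF onb]
  have entry: "L2_inner M (\<phi> j) (compress M \<phi> L T (\<phi> j))
      = (if j < L then L2_inner M (\<phi> j) (T (\<phi> j)) else 0)" for j
  proof -
    have "proj_L M \<phi> L (\<phi> j) = \<phi> j" if "j < L"
    proof -
      have "(\<Sum>i<L. (if i = j then 1 else 0) * \<phi> i x) = \<phi> j x" for x
        using that by (simp add: sum.delta if_distrib[of "\<lambda>u. u * _"] cong: if_cong)
      then show ?thesis
        by (simp add: proj_L_eq[OF onb \<phi>] onb_inner[OF onb])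
    qed
    then show ?thesis
      by (simp add: compress_def inner_basis_proj_L[OF onb] bounded_ops_L2[OF T] proj_L_L2[OF onb] \<phi>)
  qed
  have "((\<lambda>j. L2_inner M (\<phi> j) (compress M \<phi> L T (\<phi> j))) has_sum
      (\<Sum>j<L. L2_inner M (\<phi> j) (compress M \<phi> L T (\<phi> j)))) UNIV"
    by (rule has_sum_finite_neutralI[of "{..<L}"]) (simp_all add: entry)
  then have "op_trace M \<phi> (compress M \<phi> L T) = (\<Sum>j<L. L2_inner M (\<phi> j) (compress M \<phi> L T (\<phi> j)))"
    unfolding op_trace_def by (rule infsumI)
  then show ?thesis by (simp add: entry)
qed

text \<open>The operator \<open>X = U\<^sub>L A\<^sub>L U\<^sub>L\<^sup>*\<close> has range in \<open>H\<^sub>L\<close> and vanishes on the orthogonal complement,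
  so the compression of \<open>\<rho>\<close> is invisible in the trace of \<open>\<rho>\<^sub>L X\<close>, and only the normalization remains.\<close>

lemma state_op_normalized_density:
  assumes flow: "measurable_flow M \<Phi>" "invariant_measure M \<Phi>" and onb: "orthonormal_basis M \<phi>"
    and A: "A \<in> bounded_ops M" and \<rho>: "\<rho> \<in> bounded_ops M"
  fixes t
  defines "X \<equiv> \<lambda>L. koopman_conj_L M \<phi> \<Phi> L t (compress M \<phi> L A)"
  shows "state_op M \<phi> (normalized_density M \<phi> L \<rho>) (X L)
    = op_trace M \<phi> (\<rho> \<circ> X L) / op_trace M \<phi> (compress M \<phi> L \<rho>)"
proof -
  note \<phi> = onb_L2[OF onb]
  note U = koopman_bounded[OF flow]
  note cU = compress_bounded[OF onb U, of L]
  note cA = compress_bounded[OF onb A, of L]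
  note V = adjoint_koopman_L(1)[OF flow onb, of L t]
  let ?C = "op_trace M \<phi> (compress M \<phi> L \<rho>)"
  have X_eq: "X L f = compress M \<phi> L (koopman \<Phi> t) (compress M \<phi> L A
      (adjoint_op M (koopman_L M \<phi> \<Phi> L t) f))" for f
    by (simp add: X_def koopman_conj_L_def koopman_L_def)
  have XL2: "X L (\<phi> j) \<in> L2 M" for j
    unfolding X_eq by (intro bounded_ops_L2[OF cU] bounded_ops_L2[OF cA] bounded_ops_L2[OF V] \<phi>)
  have PX: "proj_L M \<phi> L (X L (\<phi> j)) = X L (\<phi> j)" for j
  proof -
    have "koopman \<Phi> t (proj_L M \<phi> L (compress M \<phi> L A (adjoint_op M (koopman_L M \<phi> \<Phi> L t) (\<phi> j)))) \<in> L2 M"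
      by (intro bounded_ops_L2[OF U] proj_L_L2[OF onb] bounded_ops_L2[OF cA] bounded_ops_L2[OF V] \<phi>)
    then show ?thesis
      unfolding X_eq compress_def[of M \<phi> L "koopman \<Phi> t"] comp_apply by (rule proj_L_idem[OF onb])
  qed
  have null: "L2_inner M (\<phi> j) (\<rho> (X L (\<phi> j))) = 0" if "L \<le> j" for j
  proof -
    have "AE x in M. compress M \<phi> L (koopman \<Phi> (- t)) (\<phi> j) x = 0"
    proof -
      have "AE x in M. proj_L M \<phi> L (koopman \<Phi> (- t) (\<lambda>x. 0)) x = 0"
        by (intro bounded_op_null[OF proj_L_bounded[OF onb]] bounded_op_null[OF U]
            bounded_ops_L2[OF U] L2_zero) simp
      then show ?thesis
        by (simp add: compress_def proj_L_basis_beyond[OF onb that])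
    qed
    with adjoint_koopman_L(2)[OF flow onb \<phi>, of L t j]
    have "AE x in M. adjoint_op M (koopman_L M \<phi> \<Phi> L t) (\<phi> j) x = 0"
      by eventually_elim simp
    then have "AE x in M. \<rho> (X L (\<phi> j)) x = 0"
      using XL2 unfolding X_eq
      by (intro bounded_op_null[OF \<rho>] bounded_op_null[OF cU] bounded_op_null[OF cA]
          bounded_ops_L2[OF cA] bounded_ops_L2[OF V] \<phi>)
    then have "L2_inner M (\<phi> j) (\<rho> (X L (\<phi> j))) = L2_inner M (\<phi> j) (\<lambda>x. 0)"
      by (intro inner_AE_cong) (simp_all add: L2_measurable \<phi> bounded_ops_L2[OF \<rho> XL2])
    then show ?thesis by simp
  qed
  have "L2_inner M (\<phi> j) (normalized_density M \<phi> L \<rho> (X L (\<phi> j)))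
      = (1 / ?C) * L2_inner M (\<phi> j) (\<rho> (X L (\<phi> j)))" for j
  proof -
    have "normalized_density M \<phi> L \<rho> (X L (\<phi> j)) = (\<lambda>x. (1 / ?C) * proj_L M \<phi> L (\<rho> (X L (\<phi> j))) x)"
      by (simp add: normalized_density_def compress_def PX)
    then show ?thesis
      using null[of j]
      by (simp add: inner_scale_right[of M _ "1 / ?C"]
          inner_basis_proj_L[OF onb] bounded_ops_L2[OF \<rho> XL2] del: times_divide_eq_left)
  qed
  then have "state_op M \<phi> (normalized_density M \<phi> L \<rho>) (X L) = (1 / ?C) * op_trace M \<phi> (\<rho> \<circ> X L)"
    unfolding state_op_def op_trace_def[of M \<phi> "_ \<circ> X L"] comp_apply
    by (simp only: infsum_cmult_right')
  then show ?thesis by simp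
qed

lemma state_op_normalized_tendsto:
  assumes flow: "measurable_flow M \<Phi>" "invariant_measure M \<Phi>" and onb: "orthonormal_basis M \<phi>"
    and A: "A \<in> bounded_ops M" and \<rho>: "density_op M \<phi> \<rho>"
  shows "(\<lambda>L. state_op M \<phi> (normalized_density M \<phi> L \<rho>)
      (koopman_conj_L M \<phi> \<Phi> L t (compress M \<phi> L A))) \<longlonglongrightarrow> state_op M \<phi> \<rho> (koopman_conj M \<Phi> t A)"
proof -
  have pos: "positive_op M \<rho>" using \<rho> by (simp add: density_op_def)
  note bd = positive_opD(1)[OF pos]
  note tr = density_op_trace_has_sum[OF \<rho>]
  have C: "(\<lambda>L. op_trace M \<phi> (compress M \<phi> L \<rho>)) \<longlonglongrightarrow> 1"
    using has_sum_imp_sums[OF tr] by (simp add: op_trace_compress[OF onb bd] sums_def)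
  have "(\<lambda>L. op_trace M \<phi> (\<rho> \<circ> koopman_conj_L M \<phi> \<Phi> L t (compress M \<phi> L A)))
      \<longlonglongrightarrow> op_trace M \<phi> (\<rho> \<circ> koopman_conj M \<Phi> t A)"
    by (rule op_trace_strongly_tendsto[OF pos onb has_sum_imp_summable[OF tr]
          koopman_conj_L_tendsto[OF flow onb A]])
  from tendsto_divide[OF this C] show ?thesis
    by (simp add: state_op_normalized_density[OF flow onb A bd] state_op_def[of M \<phi> \<rho>])
qed

section \<open>Multiplication operators and pure states\<close>

lemma mult_op_bounded:
  assumes "f \<in> Linf M"
  shows "mult_op f \<in> bounded_ops M"
proof -
  obtain C0 where C0: "AE x in M. cmod (f x) \<le> C0"
    using assms by (auto simp: Linf_def)
  define C where "C = max C0 0"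
  have C: "AE x in M. cmod (f x) \<le> C" "C \<ge> 0"
    using C0 by (auto simp: C_def elim!: eventually_mono)
  have fm [measurable]: "f \<in> borel_measurable M"
    using assms by (simp add: Linf_def)
  have sq_le: "AE x in M. (cmod (f x * g x))\<^sup>2 \<le> C\<^sup>2 * (cmod (g x))\<^sup>2" for g :: "'a fn"
    using C(1)
  proof eventually_elim
    case (elim x)
    have "(cmod (f x * g x))\<^sup>2 = (cmod (f x))\<^sup>2 * (cmod (g x))\<^sup>2"
      by (simp add: norm_mult power_mult_distrib)
    then show ?case
      using elim by (simp add: mult_right_mono power_mono)
  qed
  have int: "integrable M (\<lambda>x. (cmod (f x * g x))\<^sup>2)" if g: "g \<in> L2 M" for g
  proof -
    have [measurable]: "g \<in> borel_measurable M" using g by (rule L2_measurable)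
    have "integrable M (\<lambda>x. C\<^sup>2 * (cmod (g x))\<^sup>2)"
      using g by (simp add: L2_def)
    then show ?thesis
      by (rule Bochner_Integration.integrable_bound) (use sq_le[of g] in auto)
  qed
  have L2: "mult_op f g \<in> L2 M" if g: "g \<in> L2 M" for g
  proof -
    have [measurable]: "g \<in> borel_measurable M" using g by (rule L2_measurable)
    show ?thesis using int[OF g] by (simp add: L2_def mult_op_def)
  qed
  have "L2_norm M (mult_op f g) \<le> C * L2_norm M g" if g: "g \<in> L2 M" for g
  proof -
    have "(\<integral>x. (cmod (f x * g x))\<^sup>2 \<partial>M) \<le> (\<integral>x. C\<^sup>2 * (cmod (g x))\<^sup>2 \<partial>M)"
      using g by (intro integral_mono_AE int sq_le) (simp_all add: L2_def)
    then have "L2_norm M (mult_op f g) \<le> sqrt (C\<^sup>2 * (\<integral>x. (cmod (g x))\<^sup>2 \<partial>M))"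
      by (simp add: L2_norm_def mult_op_def)
    then show ?thesis
      using C(2) by (simp add: real_sqrt_mult L2_norm_def)
  qed
  moreover have "AE x in M. mult_op f g x = mult_op f h x" if "AE x in M. g x = h x" for g h
    using that by eventually_elim (simp add: mult_op_def)
  moreover have "mult_op f (\<lambda>y. a * g y + b * h y) = (\<lambda>x. a * mult_op f g x + b * mult_op f h x)"
    for g h a b
    by (simp add: mult_op_def algebra_simps)
  ultimately show ?thesis
    using L2 by (auto simp: bounded_ops_def)
qed

lemma koopman_Linf:
  assumes "measurable_flow M \<Phi>" "invariant_measure M \<Phi>" "f \<in> Linf M"
  shows "koopman \<Phi> t f \<in> Linf M"
proof -
  have [measurable]: "\<Phi> t \<in> measurable M M" "f \<in> borel_measurable M"
    using assms by (simp_all add: measurable_flow_def Linf_def)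
  obtain C where "AE x in M. cmod (f x) \<le> C"
    using assms(3) by (auto simp: Linf_def)
  then have "AE x in M. cmod (f (\<Phi> t x)) \<le> C"
    by (rule flow_AE[OF assms(1,2)])
  then show ?thesis
    by (auto simp: Linf_def koopman_def comp_def)
qed

text \<open>The flow applied last cancels the inverse flow in the adjoint, except in the factor \<open>f\<close>.\<close>

lemma koopman_conj_mult_op:
  assumes flow: "measurable_flow M \<Phi>" "invariant_measure M \<Phi>" and g: "g \<in> L2 M"
  shows "AE x in M. koopman_conj M \<Phi> t (mult_op f) g x = koopman \<Phi> t f x * g x"
proof -
  have "AE x in M. adjoint_op M (koopman \<Phi> t) g (\<Phi> t x) = koopman \<Phi> (- t) g (\<Phi> t x)"
    by (rule flow_AE[OF flow adjoint_koopman(2)[OF flow g]])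
  then show ?thesis
    using AE_space
    by eventually_elim (simp add: koopman_conj_def koopman_def mult_op_def flow_inverse[OF flow(1)])
qed

text \<open>The operator \<open>\<langle>s, \<cdot>\<rangle> s\<close>; for \<open>s = \<surd>p\<close> it is \<open>sqrt_projection M p\<close>.\<close>

definition pure_density :: "'a measure \<Rightarrow> 'a fn \<Rightarrow> 'a opr" where
  "pure_density M s = (\<lambda>g x. L2_inner M s g * s x)"

lemma inner_pure_density:
  "L2_inner M f (pure_density M s g) = L2_inner M s g * L2_inner M f s"
  by (simp add: pure_density_def inner_scale_right)

lemma pure_density_positive:
  assumes s: "s \<in> L2 M"
  shows "positive_op M (pure_density M s)"
proof -
  have "AE x in M. pure_density M s g x = pure_density M s h x"
    if "g \<in> L2 M" "h \<in> L2 M" "AE x in M. g x = h x" for g h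
    using inner_AE_cong[OF that(1,2)[THEN L2_measurable] that(3) L2_measurable[OF s]]
    by (simp add: pure_density_def)
  moreover have "\<exists>C. \<forall>g\<in>L2 M. L2_norm M (pure_density M s g) \<le> C * L2_norm M g"
  proof (intro exI ballI)
    fix g assume "g \<in> L2 M"
    then show "L2_norm M (pure_density M s g) \<le> (L2_norm M s)\<^sup>2 * L2_norm M g"
      using mult_right_mono[OF Cauchy_Schwarz[OF s] norm_nonneg[of M s], of g]
      unfolding pure_density_def norm_scale by (simp add: power2_eq_square mult_ac)
  qed
  moreover have "pure_density M s (\<lambda>y. a * g y + b * h y)
      = (\<lambda>x. a * pure_density M s g x + b * pure_density M s h x)"
    if "g \<in> L2 M" "h \<in> L2 M" for g h a b
    by (simp add: pure_density_def inner_lincomb_right[OF s that] algebra_simps)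
  moreover have "pure_density M s g \<in> L2 M" for g
    unfolding pure_density_def by (rule L2_scale[OF s])
  ultimately have bd: "pure_density M s \<in> bounded_ops M"
    by (simp add: bounded_ops_def)
  have "L2_inner M f (pure_density M s f) = of_real ((cmod (L2_inner M s f))\<^sup>2)" for f
    unfolding inner_pure_density complex_norm_square inner_cnj ..
  then show ?thesis
    using bd by (simp add: positive_op_def del: of_real_power)
qed

text \<open>The trace against a pure state is the expansion of \<open>\<langle>s, X s\<rangle>\<close> in the basis.\<close>

lemma pure_density_trace:
  assumes "orthonormal_basis M \<phi>" "s \<in> L2 M" "X \<in> bounded_ops M"
  shows "((\<lambda>j. L2_inner M (\<phi> j) (pure_density M s (X (\<phi> j)))) has_sum L2_inner M s (X s)) UNIV"
  using basis_expansion_has_sum[OF assms(1,3,2)]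
  by (simp add: inner_pure_density mult.commute)

text \<open>A projection of rank one is its own absolute value.\<close>

lemma pure_density_density_op:
  assumes onb: "orthonormal_basis M \<phi>" and s: "s \<in> L2 M" "L2_norm M s = 1"
  shows "density_op M \<phi> (pure_density M s)"
proof -
  let ?R = "pure_density M s"
  note pos = pure_density_positive[OF s(1)]
  note bd = positive_opD(1)[OF pos]
  have tr: "((\<lambda>j. L2_inner M (\<phi> j) (?R (\<phi> j))) has_sum 1) UNIV"
    using pure_density_trace[OF onb s(1) id_bounded] by (simp add: inner_self s(2))
  have "AE x in M. ?R (?R f) x = adjoint_op M ?R (?R f) x" if "f \<in> L2 M" for f
  proof -
    have "AE x in M. adjoint_op M ?R (?R f) x = ?R (?R f) x"
      by (rule adjoint_op_eq(2)[OF bd bounded_ops_L2[OF bd] positive_op_hermitian[OF pos]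
            bounded_ops_L2[OF bd that]])
    then show ?thesis by eventually_elim simp
  qed
  then have "trace_class M \<phi> ?R"
    unfolding trace_class_def using bd pos has_sum_imp_summable[OF tr] by blast
  then show ?thesis
    using pos infsumI[OF tr] by (simp add: density_op_def op_trace_def)
qed

lemma sqrt_density_L2:
  assumes "prob_density M p"
  defines "s \<equiv> \<lambda>x. complex_of_real (sqrt (p x))"
  shows "s \<in> L2 M" "L2_norm M s = 1"
proof -
  have int: "integrable M p" and [measurable]: "p \<in> borel_measurable M"
    using assms(1) by (auto simp: prob_density_def)
  have eq: "AE x in M. (cmod (s x))\<^sup>2 = p x"
    using assms(1) by (auto simp: prob_density_def s_def elim!: eventually_mono)
  have [measurable]: "s \<in> borel_measurable M"
    unfolding s_def by measurable
  have "integrable M (\<lambda>x. (cmod (s x))\<^sup>2)"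
    using integrable_cong_AE[of "\<lambda>x. (cmod (s x))\<^sup>2" M p] eq int by simp
  then show "s \<in> L2 M"
    by (simp add: L2_def)
  have "(\<integral>x. (cmod (s x))\<^sup>2 \<partial>M) = (\<integral>x. p x \<partial>M)"
    using eq by (intro integral_cong_AE) simp_all
  then show "L2_norm M s = 1"
    using assms(1) by (simp add: L2_norm_def prob_density_def)
qed

lemma inner_sqrt_density:
  assumes p: "prob_density M p" and F: "F \<in> Linf M"
    and X: "X \<in> L2 M" "AE x in M. X x = F x * complex_of_real (sqrt (p x))"
  shows "L2_inner M (\<lambda>x. complex_of_real (sqrt (p x))) X = state_fn M p F"
proof -
  have [measurable]: "p \<in> borel_measurable M" "F \<in> borel_measurable M" "X \<in> borel_measurable M"
    using p F X(1) by (auto simp: prob_density_def Linf_def L2_def)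
  have "AE x in M. 0 \<le> p x" using p by (simp add: prob_density_def)
  with X(2) have "AE x in M. cnj (complex_of_real (sqrt (p x))) * X x = F x * complex_of_real (p x)"
  proof eventually_elim
    case (elim x)
    then have "complex_of_real (sqrt (p x)) * complex_of_real (sqrt (p x)) = complex_of_real (p x)"
      by (simp flip: of_real_mult)
    then show ?case
      by (simp add: elim(1) mult.left_commute)
  qed
  then show ?thesis
    unfolding L2_inner_def state_fn_def by (intro integral_cong_AE) simp_all
qed

section \<open>Consistency of the projected transfer operators\<close>

theorem mainTheorem4:
  fixes M :: "'a::polish_space measure"
    and \<Phi> :: "real \<Rightarrow> 'a \<Rightarrow> 'a"
    and \<phi> :: "nat \<Rightarrow> 'a \<Rightarrow> complex"
  assumes "prob_space M" and "sets M = sets borel"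
    and "measurable_flow M \<Phi>" and "invariant_measure M \<Phi>" and "ergodic_flow M \<Phi>"
    and "orthonormal_basis M \<phi>" and "\<forall>j. \<phi> j \<in> Linf M"
  shows "(\<forall>t. \<forall>\<omega>\<in>normal_states_op M \<phi>. \<forall>A\<in>bounded_ops M.
            (\<lambda>L. (transfer_op_L M \<phi> \<Phi> L t \<circ> project_state M \<phi> L) \<omega> (compress M \<phi> L A))
              \<longlonglongrightarrow> transfer_op M \<Phi> t \<omega> A)
       \<and> (\<forall>t. \<forall>f\<in>Linf M. \<forall>\<omega>\<in>normal_states_fn M.
            (\<lambda>L. (transfer_op_L M \<phi> \<Phi> L t \<circ> project_state M \<phi> L) (state_embedding M \<phi> \<omega>)
                   (mult_op_L M \<phi> L f))
              \<longlonglongrightarrow> transfer_op M \<Phi> t (state_embedding M \<phi> \<omega>) (mult_op f)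
          \<and> transfer_op M \<Phi> t (state_embedding M \<phi> \<omega>) (mult_op f) = transfer_fn \<Phi> t \<omega> f)"
proof -
  note flow = assms(3,4)
  note onb = assms(6)
  have limit: "(\<lambda>L. (transfer_op_L M \<phi> \<Phi> L t \<circ> project_state M \<phi> L) \<omega> (compress M \<phi> L A))
      \<longlonglongrightarrow> transfer_op M \<Phi> t \<omega> A"
    if \<omega>: "\<omega> \<in> normal_states_op M \<phi>" and A: "A \<in> bounded_ops M" for t \<omega> A
  proof -
    define \<rho> where "\<rho> = (SOME \<rho>. is_density_op M \<phi> \<omega> \<rho>)"
    have "is_density_op M \<phi> \<omega> \<rho>"
      using \<omega> unfolding \<rho>_def normal_states_op_def by (simp add: someI_ex)
    then have \<rho>: "density_op M \<phi> \<rho>"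
      and value_eq: "\<And>B. B \<in> bounded_ops M \<Longrightarrow> \<omega> B = state_op M \<phi> \<rho> B"
      by (simp_all add: is_density_op_def)
    show ?thesis
      using state_op_normalized_tendsto[OF flow onb A \<rho>, of t]
      by (simp add: transfer_op_L_def project_state_def transfer_op_def
          value_eq[OF koopman_conj_bounded[OF flow A]] flip: \<rho>_def)
  qed
  have pure: "(\<lambda>L. (transfer_op_L M \<phi> \<Phi> L t \<circ> project_state M \<phi> L) (state_embedding M \<phi> \<omega>)
             (mult_op_L M \<phi> L f))
        \<longlonglongrightarrow> transfer_op M \<Phi> t (state_embedding M \<phi> \<omega>) (mult_op f)
      \<and> transfer_op M \<Phi> t (state_embedding M \<phi> \<omega>) (mult_op f) = transfer_fn \<Phi> t \<omega> f"
    if f: "f \<in> Linf M" and \<omega>: "\<omega> \<in> normal_states_fn M" for t f \<omega>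
  proof
    \<comment> \<open>A density of \<open>\<omega>\<close> is only determined up to null sets; \<open>p\<close> is the one on which
      \<open>state_embedding\<close> is built.\<close>
    define p where "p = (SOME p. is_density_fn M \<omega> p)"
    have "is_density_fn M \<omega> p"
      using \<omega> unfolding p_def normal_states_fn_def by (simp add: someI_ex)
    then have p: "prob_density M p" and value_eq: "\<And>g. g \<in> Linf M \<Longrightarrow> \<omega> g = state_fn M p g"
      by (simp_all add: is_density_fn_def)
    define s where "s = (\<lambda>x. complex_of_real (sqrt (p x)))"
    have s: "s \<in> L2 M" "L2_norm M s = 1"
      unfolding s_def by (rule sqrt_density_L2[OF p])+
    have emb: "state_embedding M \<phi> \<omega> = state_op M \<phi> (pure_density M s)"
      by (simp add: state_embedding_def sqrt_projection_def Let_def pure_density_def s_def flip: p_def)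
    note mf = mult_op_bounded[OF f]
    have "state_embedding M \<phi> \<omega> \<in> normal_states_op M \<phi>"
      using pure_density_density_op[OF onb s]
      by (auto simp: normal_states_op_def is_density_op_def emb)
    from limit[OF this mf, of t]
    show "(\<lambda>L. (transfer_op_L M \<phi> \<Phi> L t \<circ> project_state M \<phi> L) (state_embedding M \<phi> \<omega>)
             (mult_op_L M \<phi> L f))
        \<longlonglongrightarrow> transfer_op M \<Phi> t (state_embedding M \<phi> \<omega>) (mult_op f)"
      by (simp add: mult_op_L_def)
    let ?X = "koopman_conj M \<Phi> t (mult_op f)"
    note X = koopman_conj_bounded[OF flow mf, of t]
    have "transfer_op M \<Phi> t (state_embedding M \<phi> \<omega>) (mult_op f) = L2_inner M s (?X s)"
      using infsumI[OF pure_density_trace[OF onb s(1) X]]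
      by (simp add: transfer_op_def emb state_op_def op_trace_def)
    also have "\<dots> = state_fn M p (koopman \<Phi> t f)"
      using koopman_conj_mult_op[OF flow s(1), of t f] bounded_ops_L2[OF X s(1)]
      unfolding s_def by (intro inner_sqrt_density p koopman_Linf flow f)
    also have "\<dots> = transfer_fn \<Phi> t \<omega> f"
      by (simp add: transfer_fn_def value_eq[OF koopman_Linf[OF flow f]])
    finally show "transfer_op M \<Phi> t (state_embedding M \<phi> \<omega>) (mult_op f) = transfer_fn \<Phi> t \<omega> f" .
  qed
  show ?thesis
    by (intro conjI allI ballI limit pure[THEN conjunct1] pure[THEN conjunct2])
qed

end
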